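(* Let $p$ be an odd prime, $u$ and $v$ distinct prime numbers, $n=uv$, $N=p^{uv}-1$, $\alpha$ a primitive element of $\mathbb{F}_{p^n}$, and let $C$ be the dual of the $p$-ary BCH code of length $N$ and designed distance $3$, $$C=\left\{\left(\mathrm{Tr}_{\mathbb{F}_{p^n}/\mathbb{F}_p}(\lambda\alpha^k+\beta\alpha^{2k})\right)_{0\le k\le N-1}:\lambda,\beta\in\mathbb{F}_{p^n}\right\}.$$ Let $L_1=\frac{p^{uv}-1}{p-1}$, $L_2=\frac{p^{uv}-1}{p^u-1}$, $L_3=\frac{p^{uv}-1}{p^v-1}$, and $A=N(uv,p)-N(u,p^v)-N(v,p^u)+1$. Then $C$ has $3$ cyclic subcodes (including itself) for any $u$ and $v$. Moreover: (i) If $u$ and $v$ are odd, then $C$ has $$A+A\bigl(N(uv,p)+N(u,p^v)+N(v,p^u)\bigr)+2\bigl(N(u,p^v)N(v,p^u)-N(u,p^v)-N(v,p^u)+1\bigr)$$ quasi-cyclic subcodes of index $L_1$, $2N(v,p^u)+N(v,p^u)^2-3$ quasi-cyclic subcodes of index $L_2$, and $2N(u,p^v)+N(u,p^v)^2-3$ quasi-cyclic subcodes of index $L_3$. (ii) If $u=2$ and $v$ is an odd prime, then $C$ has $$A+A\,N(uv,p)+(N(u,p^v)-1)(A+N(v,p^u)-1)$$ quasi-cyclic subcodes of index $L_1$, $$2A+(N(v,p^u)-1)(A+N(u,p^v)-1)$$ quasi-cyclic subcodes of index $L_1/2$, $2N(v,p^u)+N(v,p^u)^2-3$ quasi-cyclic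 subcodes of index $L_2$, $N(u,p^v)^2-1$ quasi-cyclic subcodes of index $L_3$, and $2(N(u,p^v)-1)$ quasi-cyclic subcodes of index $L_3/2$.
   Context: A linear code $D\subseteq\mathbb{F}_p^N$ is quasi-cyclic of index $\ell$ if it is invariant under cyclic shift of codewords by $\ell$ positions and $\ell$ is the smallest positive integer with this property; index $1$ means cyclic. The zero code is not counted among the subcodes. For a prime power $Q$ and $m\ge 1$, $N(m,Q)$ denotes the number of nonzero $\mathbb{F}_Q$-subspaces of an $m$-dimensional $\mathbb{F}_Q$-vector space: $$N(m,Q)=\sum_{k=1}^{m}\frac{(Q^m-1)(Q^m-Q)\cdots(Q^m-Q^{k-1})}{(Q^k-1)(Q^k-Q)\cdots(Q^k-Q^{k-1})}.$$ *)

theory Defs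
  imports Complex_Main "HOL-Library.Cardinality" "Jordan_Normal_Form.Matrix"
begin

text \<open>
  The field with p^n elements is a type of class field and finite whose cardinality is p^n, and
  the field with p elements is its prime subfield. Words of length N over the latter are vectors
  over the big field with all entries in the prime subfield.
\<close>

definition prime_subfield :: "'a :: field set" where
  "prime_subfield = range of_nat"

definition primitive_element :: "'a :: field \<Rightarrow> bool" where
  "primitive_element \<alpha> \<longleftrightarrow> range (\<lambda>k :: nat. \<alpha> ^ k) = UNIV - {0}"

definition field_trace :: "nat \<Rightarrow> nat \<Rightarrow> 'a :: field \<Rightarrow> 'a" where
  "field_trace p n x = (\<Sum>i<n. x ^ (p ^ i))"

definition linear_code :: "nat \<Rightarrow> 'a :: field vec set \<Rightarrow> bool" where
  "linear_code N D \<longleftrightarrow>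
     D \<subseteq> {c \<in> carrier_vec N. \<forall>k<N. c $ k \<in> prime_subfield} \<and>
     0\<^sub>v N \<in> D \<and>
     (\<forall>c\<in>D. \<forall>d\<in>D. c + d \<in> D) \<and>
     (\<forall>a\<in>prime_subfield. \<forall>c\<in>D. a \<cdot>\<^sub>v c \<in> D)"

text \<open>
  The word (c(0), ..., c(N-1)) is sent to (c(N-1), c(0), ..., c(N-2)).
\<close>

definition cyclic_shift :: "'a vec \<Rightarrow> 'a vec" where
  "cyclic_shift c = vec (dim_vec c) (\<lambda>k. c $ ((k + dim_vec c - 1) mod dim_vec c))"

definition shift_invariant :: "nat \<Rightarrow> 'a vec set \<Rightarrow> bool" where
  "shift_invariant l D \<longleftrightarrow> (\<forall>c\<in>D. (cyclic_shift ^^ l) c \<in> D)"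

definition quasi_cyclic :: "nat \<Rightarrow> nat \<Rightarrow> 'a :: field vec set \<Rightarrow> bool" where
  "quasi_cyclic N l D \<longleftrightarrow>
     linear_code N D \<and> 0 < l \<and> shift_invariant l D \<and>
     (\<forall>m. 0 < m \<and> m < l \<longrightarrow> \<not> shift_invariant m D)"

definition cyclic_code :: "nat \<Rightarrow> 'a :: field vec set \<Rightarrow> bool" where
  "cyclic_code N D \<longleftrightarrow> quasi_cyclic N 1 D"

definition subcodes :: "nat \<Rightarrow> 'a :: field vec set \<Rightarrow> 'a vec set set" where
  "subcodes N C = {D. linear_code N D \<and> D \<subseteq> C \<and> D \<noteq> {0\<^sub>v N}}"

definition num_qc_subcodes :: "nat \<Rightarrow> 'a :: field vec set \<Rightarrow> nat \<Rightarrow> nat" where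
  "num_qc_subcodes N C l = card {D \<in> subcodes N C. quasi_cyclic N l D}"

text \<open>
  The trace description of the dual of the p-ary BCH code with zeros \<alpha> and \<alpha>^2 (narrow sense,
  length N, designed distance 3) is taken as the definition of this dual.
\<close>

definition dual_BCH3 :: "nat \<Rightarrow> nat \<Rightarrow> nat \<Rightarrow> 'a :: field \<Rightarrow> 'a vec set" where
  "dual_BCH3 p n N \<alpha> =
     {vec N (\<lambda>k. field_trace p n (l * \<alpha> ^ k + b * \<alpha> ^ (2 * k))) | l b. True}"

text \<open>
  N(m,Q), the number of nonzero subspaces of an m-dimensional space over the field with Q elements,
  as a sum of Gaussian binomial coefficients; the quotients are exact.
\<close>

definition num_subspaces :: "nat \<Rightarrow> nat \<Rightarrow> real" where
  "num_subspaces m Q =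
     (\<Sum>k=1..m. (\<Prod>i<k. real Q ^ m - real Q ^ i) / (\<Prod>i<k. real Q ^ k - real Q ^ i))"

end

theory Submission
  imports Defs "HOL-Number_Theory.Pocklington" "HOL-Computational_Algebra.Polynomial"
    "HOL-Library.Product_Plus"
begin

text \<open>
  The trace form identifies C with pairs (l, b) of field elements, and a cyclic shift becomes the
  action of the inverse of \<alpha>, where x acts by (l, b) \<mapsto> (x l, x^2 b). The nonzero x that preserve
  a given subcode form a group of e-th roots of unity with e dividing N, and the subcode is
  quasi-cyclic of index N / e. All orders e in question are even, so -1 preserves the subcode,
  which therefore splits as W \<times> W'. The elements x with x W \<subseteq> W form a subfield with p^d elements,
  those for W' a subfield with p^d' elements, and e = gcd (p^d - 1) (2 (p^d' - 1)), which equals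
  p^g - 1 or 2 (p^g - 1) for g = gcd d d', the latter iff d / g is even. It remains to count the
  subspaces of the field whose stabilizer is a given subfield; since n = u v there are only four
  subfields, and inclusion-exclusion over the Gaussian binomial counts gives
  A, N(v, p^u) - 1, N(u, p^v) - 1 and 2.
\<close>

section \<open>Counting subspaces over a finite subfield\<close>

text \<open>The obstacle is that a shift multiplies the two coordinates by different powers of
  \<open>\<alpha>\<close>. A subcode is linear over the prime field, but scalar multiplication there
  is not the weighted action, and the group of nonzero x preserving a subcode need not come from a
  subfield. Once the coordinates separate, each factor is an ordinary subspace with a genuine field
  of multipliers. The second factor restricts only x^2, and this is the origin of the 2 in 2 (p^d' -
  1) and of the halved indices: for u = 2 the quotient d / g is even exactly when d has the factor 2
  and d' does not, while for odd u and v it is never even. The identification of words with pairs is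
  faithful because the trace of l x + b x^2 is a polynomial in x of degree at most 2 p^(n-1), less
  than p^n as p is odd. The count 2 belongs to the stabilizer that is the whole field: only the zero
  subspace and the field itself have it. So 2 * 2 pairs have order N, and removing the zero code
  leaves the 3 cyclic subcodes.\<close>

definition subfield_set :: "'a :: field set \<Rightarrow> bool" where
  "subfield_set K \<longleftrightarrow> 0 \<in> K \<and> 1 \<in> K \<and> (\<forall>x\<in>K. \<forall>y\<in>K. x + y \<in> K \<and> x * y \<in> K) \<and>
     (\<forall>x\<in>K. - x \<in> K \<and> inverse x \<in> K)"

definition subspace_over :: "'a :: field set \<Rightarrow> 'a set \<Rightarrow> bool" where
  "subspace_over K W \<longleftrightarrow> 0 \<in> W \<and> (\<forall>x\<in>W. \<forall>y\<in>W. x + y \<in> W) \<and> (\<forall>a\<in>K. \<forall>x\<in>W. a * x \<in> W)"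

fun span_list :: "'a :: field set \<Rightarrow> 'a list \<Rightarrow> 'a set" where
  "span_list K [] = {0}"
| "span_list K (x # xs) = (\<lambda>(a, y). a * x + y) ` (K \<times> span_list K xs)"

text \<open>Independence tests the head against the span of the tail, so lists grow by prepending
  and each extension has to avoid a set of known size.\<close>

fun indep_list :: "'a :: field set \<Rightarrow> 'a list \<Rightarrow> bool" where
  "indep_list K [] \<longleftrightarrow> True"
| "indep_list K (x # xs) \<longleftrightarrow> x \<notin> span_list K xs \<and> indep_list K xs"

lemma subspace_overI:
  assumes "0 \<in> W" "\<And>x y. x \<in> W \<Longrightarrow> y \<in> W \<Longrightarrow> x + y \<in> W" "\<And>a x. a \<in> K \<Longrightarrow> x \<in> W \<Longrightarrow> a * x \<in> W"
  shows "subspace_over K W"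
  using assms by (auto simp: subspace_over_def)

lemma subspace_over_span_list:
  assumes K: "subfield_set K"
  shows "subspace_over K (span_list K xs)"
proof (induction xs)
  case Nil
  show ?case by (simp add: subspace_over_def)
next
  case (Cons x xs)
  have mem: "a * x + y \<in> span_list K (x # xs)" if "a \<in> K" "y \<in> span_list K xs" for a y
    using that by force
  show ?case
  proof (rule subspace_overI)
    show "0 \<in> span_list K (x # xs)"
      using mem[of 0 0] K Cons by (simp add: subfield_set_def subspace_over_def)
  next
    fix w z assume "w \<in> span_list K (x # xs)" "z \<in> span_list K (x # xs)"
    then obtain a y b y' where *: "w = a * x + y" "a \<in> K" "y \<in> span_list K xs"
        "z = b * x + y'" "b \<in> K" "y' \<in> span_list K xs"
      by auto
    have "(a + b) * x + (y + y') \<in> span_list K (x # xs)"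
      by (rule mem) (use * K Cons in \<open>auto simp: subfield_set_def subspace_over_def\<close>)
    moreover have "w + z = (a + b) * x + (y + y')" by (simp add: * algebra_simps)
    ultimately show "w + z \<in> span_list K (x # xs)" by (simp only:)
  next
    fix c w assume c: "c \<in> K" and "w \<in> span_list K (x # xs)"
    then obtain a y where *: "w = a * x + y" "a \<in> K" "y \<in> span_list K xs"
      by auto
    have "(c * a) * x + c * y \<in> span_list K (x # xs)"
      by (rule mem) (use * c K Cons in \<open>auto simp: subfield_set_def subspace_over_def\<close>)
    moreover have "c * w = (c * a) * x + c * y" by (simp add: * algebra_simps)
    ultimately show "c * w \<in> span_list K (x # xs)" by (simp only:)
  qed
qed

lemma span_list_subset:
  assumes "subspace_over K W" "set xs \<subseteq> W"
  shows "span_list K xs \<subseteq> W"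
  using assms(2)
proof (induction xs)
  case Nil
  then show ?case using assms(1) by (simp add: subspace_over_def)
next
  case (Cons x xs)
  then show ?case using assms(1) by (auto simp: subspace_over_def)
qed

lemma set_subset_span_list:
  assumes K: "subfield_set K"
  shows "set xs \<subseteq> span_list K xs"
proof (induction xs)
  case (Cons x xs)
  have 0: "0 \<in> span_list K xs" and K01: "0 \<in> K" "1 \<in> K"
    using subspace_over_span_list[OF K] K by (auto simp: subspace_over_def subfield_set_def)
  have "x \<in> span_list K (x # xs)"
    using 0 K01 by (auto intro!: image_eqI[of _ _ "(1, 0)"])
  moreover have "y \<in> span_list K (x # xs)" if "y \<in> span_list K xs" for y
    using that K01 by (auto intro!: image_eqI[of _ _ "(0, y)"])
  ultimately show ?case using Cons by auto
qed simp

lemma card_span_list: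
  fixes K :: "'a :: {field, finite} set"
  assumes K: "subfield_set K" and "indep_list K xs"
  shows "card (span_list K xs) = card K ^ length xs"
  using assms(2)
proof (induction xs)
  case (Cons x xs)
  have S: "subspace_over K (span_list K xs)"
    by (rule subspace_over_span_list[OF K])
  have "inj_on (\<lambda>(a, y). a * x + y) (K \<times> span_list K xs)"
  proof (rule inj_onI, clarify)
    fix a y b z
    assume *: "a \<in> K" "b \<in> K" "y \<in> span_list K xs" "z \<in> span_list K xs" "a * x + y = b * x + z"
    have "a = b"
    proof (rule ccontr)
      \<comment> \<open>Two representations with different leading coefficients could be solved for
        \<open>x\<close>, placing it in the span of the tail.\<close>
      assume "a \<noteq> b"
      have "inverse (a - b) \<in> K"
        using K *(1,2) unfolding subfield_set_def by (metis diff_conv_add_uminus)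
      moreover have "z - y \<in> span_list K xs"
      proof -
        have "- 1 \<in> K" using K by (simp add: subfield_set_def)
        then have "(- 1) * y \<in> span_list K xs"
          using S *(3) unfolding subspace_over_def by blast
        then have "z + (- 1) * y \<in> span_list K xs"
          using S *(4) unfolding subspace_over_def by blast
        then show ?thesis by simp
      qed
      ultimately have "inverse (a - b) * (z - y) \<in> span_list K xs"
        using S unfolding subspace_over_def by blast
      moreover have "x = inverse (a - b) * (z - y)"
        using *(5) \<open>a \<noteq> b\<close> by (simp add: field_simps)
      ultimately show False using Cons.prems by simp
    qed
    then show "a = b \<and> y = z" using *(5) by simp
  qed
  then have "card (span_list K (x # xs)) = card (K \<times> span_list K xs)"
    by (simp add: card_image)
  then show ?case using Cons by (simp add: card_cartesian_product)
qed simp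

lemma card_subfield_set_gt_1:
  fixes K :: "'a :: {field, finite} set"
  assumes "subfield_set K"
  shows "1 < card K"
proof -
  have "{0, 1} \<subseteq> K" using assms by (simp add: subfield_set_def)
  then have "card {0 :: 'a, 1} \<le> card K" by (intro card_mono) auto
  then show ?thesis by simp
qed

text \<open>A list of length j extends by any vector of \<open>W\<close> outside its span, and the
  span has \<open>card K ^ j\<close> elements. For j beyond the dimension of \<open>W\<close> a
  factor of the product vanishes.\<close>

lemma card_indep_lists:
  fixes K :: "'a :: {field, finite} set"
  assumes K: "subfield_set K" and W: "subspace_over K W"
  shows "real (card {xs. length xs = j \<and> set xs \<subseteq> W \<and> indep_list K xs}) =
    (\<Prod>i<j. real (card W) - real (card K) ^ i)"
proof (induction j)
  case 0
  have "{xs. length xs = 0 \<and> set xs \<subseteq> W \<and> indep_list K xs} = {[]}" by auto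
  then show ?case by simp
next
  case (Suc j)
  let ?S = "\<lambda>j. {xs. length xs = j \<and> set xs \<subseteq> W \<and> indep_list K xs}"
  have fin: "finite (?S j)"
    by (rule finite_subset[OF _ finite_lists_length_eq[of W j]]) auto
  have "?S (Suc j) = (\<lambda>(xs, x). x # xs) ` (SIGMA xs:?S j. W - span_list K xs)"
    by (auto simp: length_Suc_conv image_iff)
  then have "card (?S (Suc j)) = card (SIGMA xs:?S j. W - span_list K xs)"
    by (simp only:) (rule card_image, auto simp: inj_on_def)
  also have "\<dots> = (\<Sum>xs\<in>?S j. card (W - span_list K xs))"
    by (rule card_SigmaI) (use fin in auto)
  finally have "real (card (?S (Suc j))) = (\<Sum>xs\<in>?S j. real (card (W - span_list K xs)))"
    by simp
  also have "\<dots> = (\<Sum>xs\<in>?S j. real (card W) - real (card K) ^ j)"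
  proof (rule sum.cong[OF refl])
    fix xs assume xs: "xs \<in> ?S j"
    then have sub: "span_list K xs \<subseteq> W" using span_list_subset[OF W] by auto
    then have "card (span_list K xs) \<le> card W" by (intro card_mono) auto
    then show "real (card (W - span_list K xs)) = real (card W) - real (card K) ^ j"
      using xs sub card_span_list[OF K, of xs] by (simp add: card_Diff_subset of_nat_diff)
  qed
  finally show ?case using Suc by simp
qed

text \<open>A longest independent list in \<open>W\<close> spans \<open>W\<close>, since a vector
  outside its span could be prepended. A longest one exists because k < \<open>card K ^ k\<close> <=
  \<open>card W\<close> bounds the length k.\<close>

lemma exists_basis_list:
  fixes K :: "'a :: {field, finite} set"
  assumes K: "subfield_set K" and W: "subspace_over K W"
  obtains xs where "set xs \<subseteq> W" "indep_list K xs" "span_list K xs = W"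
proof -
  let ?P = "\<lambda>k. \<exists>xs. length xs = k \<and> set xs \<subseteq> W \<and> indep_list K xs"
  have bound: "k < card W" if k: "?P k" for k
  proof -
    obtain xs where xs: "length xs = k" "set xs \<subseteq> W" "indep_list K xs" using k by blast
    have "k < card K ^ k"
      using card_subfield_set_gt_1[OF K] by (intro power_gt_expt) auto
    also have "\<dots> = card (span_list K xs)" using card_span_list[OF K xs(3)] xs by simp
    also have "\<dots> \<le> card W" using span_list_subset[OF W xs(2)] by (intro card_mono) auto
    finally show ?thesis by simp
  qed
  have "\<exists>k. ?P k \<and> (\<forall>y. ?P y \<longrightarrow> y \<le> k)"
    by (rule ex_has_greatest_nat[of ?P 0 "\<lambda>k. k" "card W"]) (rule exI[of _ "[]"], simp, intro allI impI, rule bound)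
  then obtain k where k: "?P k \<and> (\<forall>y. ?P y \<longrightarrow> y \<le> k)" ..
  obtain xs where xs: "length xs = k" "set xs \<subseteq> W" "indep_list K xs" using conjunct1[OF k] by blast
  have "W \<subseteq> span_list K xs"
  proof
    fix x assume x: "x \<in> W"
    show "x \<in> span_list K xs"
    proof (rule ccontr)
      assume "x \<notin> span_list K xs"
      then have "?P (Suc k)" using xs x by (intro exI[of _ "x # xs"]) auto
      then show False using conjunct2[OF k] by force
    qed
  qed
  then show ?thesis using that xs span_list_subset[OF W xs(2)] by blast
qed

lemma card_subspace_over:
  fixes K :: "'a :: {field, finite} set"
  assumes K: "subfield_set K" and W: "subspace_over K W"
  obtains k where "card W = card K ^ k"
  using exists_basis_list[OF assms] card_span_list[OF K] by metis

text \<open>Double counting: the independent lists of length k in the whole field are grouped by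
  their span, and every subspace of size \<open>card K ^ k\<close> is the span of equally many of
  them.\<close>

lemma card_subspaces_of_dim:
  fixes K :: "'a :: {field, finite} set"
  assumes K: "subfield_set K" and m: "CARD('a) = card K ^ m"
  shows "real (card {W. subspace_over K W \<and> card W = card K ^ k}) *
      (\<Prod>i<k. real (card K) ^ k - real (card K) ^ i) = (\<Prod>i<k. real (card K) ^ m - real (card K) ^ i)"
proof -
  let ?Q = "card K"
  let ?WW = "{W. subspace_over K W \<and> card W = ?Q ^ k}"
  let ?S = "\<lambda>W. {xs. length xs = k \<and> set xs \<subseteq> W \<and> indep_list K xs}"
  have fin: "finite (?S W)" for W
    by (rule finite_subset[OF _ finite_lists_length_eq[of W k]]) auto
  \<comment> \<open>The span lies in \<open>W\<close> and has the same size, so \<open>W\<close> is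
    recovered from any of its lists and the groups are disjoint.\<close>
  have span_eq: "span_list K xs = W" if "W \<in> ?WW" "xs \<in> ?S W" for W xs
    using that span_list_subset[of K W xs] card_span_list[OF K, of xs]
    by (intro card_subset_eq) auto
  have S_eq: "?S UNIV = (\<Union>W\<in>?WW. ?S W)"
  proof (intro equalityI subsetI)
    fix xs assume xs: "xs \<in> ?S UNIV"
    then have "span_list K xs \<in> ?WW"
      using subspace_over_span_list[OF K] card_span_list[OF K] by auto
    moreover have "xs \<in> ?S (span_list K xs)" using xs set_subset_span_list[OF K] by auto
    ultimately show "xs \<in> (\<Union>W\<in>?WW. ?S W)" by blast
  qed auto
  have disj: "?S W \<inter> ?S W' = {}" if "W \<in> ?WW" "W' \<in> ?WW" "W \<noteq> W'" for W W'
    using span_eq[OF that(1)] span_eq[OF that(2)] that(3) by blast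
  have "card (?S UNIV) = (\<Sum>W\<in>?WW. card (?S W))"
    unfolding S_eq
  proof (rule card_UN_disjoint)
    show "\<forall>W\<in>?WW. finite (?S W)" using fin by blast
    show "\<forall>W\<in>?WW. \<forall>W'\<in>?WW. W \<noteq> W' \<longrightarrow> ?S W \<inter> ?S W' = {}" using disj by blast
  qed simp
  then have "real (card (?S UNIV)) = (\<Sum>W\<in>?WW. real (card (?S W)))" by simp
  also have "\<dots> = (\<Sum>W\<in>?WW. (\<Prod>i<k. real ?Q ^ k - real ?Q ^ i))"
    by (rule sum.cong[OF refl]) (simp add: card_indep_lists[OF K])
  finally have "real (card (?S UNIV)) = real (card ?WW) * (\<Prod>i<k. real ?Q ^ k - real ?Q ^ i)"
    by simp
  moreover have "real (card (?S UNIV)) = (\<Prod>i<k. real ?Q ^ m - real ?Q ^ i)"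
    using card_indep_lists[OF K, of UNIV k] m by (simp add: subspace_over_def)
  ultimately show ?thesis by simp
qed

lemma card_subspaces:
  fixes K :: "'a :: {field, finite} set"
  assumes K: "subfield_set K" and m: "CARD('a) = card K ^ m"
  shows "real (card {W. subspace_over K W}) = num_subspaces m (card K) + 1"
proof -
  let ?Q = "card K"
  let ?X = "\<lambda>k. {W. subspace_over K W \<and> card W = ?Q ^ k}"
  have Q: "1 < ?Q" by (rule card_subfield_set_gt_1[OF K])
  have "{W. subspace_over K W} = (\<Union>k\<in>{..m}. ?X k)"
  proof (intro equalityI subsetI)
    fix W assume "W \<in> {W. subspace_over K W}"
    then have W: "subspace_over K W" by simp
    then obtain k where k: "card W = ?Q ^ k" by (rule card_subspace_over[OF K])
    have "?Q ^ k \<le> ?Q ^ m" using card_mono[of UNIV W] k m by simp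
    then have "k \<le> m" using Q by simp
    then show "W \<in> (\<Union>k\<in>{..m}. ?X k)" using W k by blast
  qed auto
  then have "card {W. subspace_over K W} = (\<Sum>k\<le>m. card (?X k))"
    using Q by (simp only:) (rule card_UN_disjoint, auto)
  then have "real (card {W. subspace_over K W}) = (\<Sum>k\<le>m. real (card (?X k)))"
    by simp
  also have "\<dots> = (\<Sum>k\<le>m. (\<Prod>i<k. real ?Q ^ m - real ?Q ^ i) / (\<Prod>i<k. real ?Q ^ k - real ?Q ^ i))"
  proof (rule sum.cong[OF refl])
    fix k
    have "(\<Prod>i<k. real ?Q ^ k - real ?Q ^ i) \<noteq> 0" using Q by (auto simp flip: of_nat_power)
    then show "real (card (?X k)) = (\<Prod>i<k. real ?Q ^ m - real ?Q ^ i) / (\<Prod>i<k. real ?Q ^ k - real ?Q ^ i)"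
      using card_subspaces_of_dim[OF K m, of k] by (simp add: field_simps)
  qed
  also have "\<dots> = num_subspaces m ?Q + 1"
  proof -
    \<comment> \<open>The index 0 is the zero subspace, which \<open>num_subspaces\<close> leaves
      out; its two empty products give the added 1.\<close>
    have "{..m} = insert 0 {1..m}" by auto
    then show ?thesis by (simp add: num_subspaces_def)
  qed
  finally show ?thesis .
qed

lemma num_subspaces_1: "1 < Q \<Longrightarrow> num_subspaces 1 Q = 1"
  by (simp add: num_subspaces_def)

section \<open>Greatest common divisors of numbers q^a - 1\<close>

lemma power_diff_one_dvd:
  fixes q :: nat
  assumes "d dvd m" "0 < q"
  shows "q ^ d - 1 dvd q ^ m - 1"
proof -
  obtain k where "m = d * k" using assms by blast
  then have "int (q ^ m) - 1 = (int (q ^ d) - 1) * (\<Sum>i<k. int (q ^ d) ^ i)"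
    using power_diff_1_eq[of "int (q ^ d)" k] by (simp add: power_mult)
  then have "int (q ^ d) - 1 dvd int (q ^ m) - 1" by simp
  moreover have "int (q ^ k) - 1 = int (q ^ k - 1)" for k
    using assms(2) by (simp add: of_nat_diff)
  ultimately show ?thesis by (simp only: int_dvd_int_iff)
qed

text \<open>A number m divides \<open>q ^ k - 1\<close> iff the multiplicative order of q modulo m
  divides k, so the common divisors of the two numbers are the divisors of the one at
  \<open>gcd a b\<close>.\<close>

lemma gcd_power_diff_one:
  fixes q :: nat
  assumes "0 < q"
  shows "gcd (q ^ a - 1) (q ^ b - 1) = q ^ gcd a b - 1"
proof (rule gcd_unique_nat[THEN iffD1, symmetric], intro conjI allI impI)
  show "q ^ gcd a b - 1 dvd q ^ a - 1" "q ^ gcd a b - 1 dvd q ^ b - 1"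
    by (simp_all only: power_diff_one_dvd gcd_dvd1 gcd_dvd2 assms)
next
  fix m assume m: "m dvd q ^ a - 1 \<and> m dvd q ^ b - 1"
  have iff: "m dvd q ^ k - 1 \<longleftrightarrow> ord m q dvd k" for k
  proof -
    have "m dvd q ^ k - 1 \<longleftrightarrow> [q ^ k = 1] (mod m)"
      using assms by (simp add: cong_altdef_nat)
    then show ?thesis by (simp only: ord_divides)
  qed
  then show "m dvd q ^ gcd a b - 1" using m by simp
qed

text \<open>The quotient is the geometric sum of a odd terms.\<close>

lemma even_geometric_quotient:
  fixes q :: nat
  assumes "odd q" "1 < q"
  shows "even ((q ^ a - 1) div (q - 1)) \<longleftrightarrow> even a"
proof -
  have "int (q ^ a - 1) = int ((q - 1) * (\<Sum>i<a. q ^ i))"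
    using power_diff_1_eq[of "int q" a] assms by (simp add: of_nat_diff)
  then have "q ^ a - 1 = (q - 1) * (\<Sum>i<a. q ^ i)" by (simp only: of_nat_eq_iff)
  moreover have "even (\<Sum>i<a. q ^ i) \<longleftrightarrow> even a"
    using assms by (induction a) auto
  ultimately show ?thesis using assms by simp
qed

text \<open>Dividing both \<open>q ^ a - 1\<close> and \<open>q ^ b - 1\<close> by
  \<open>r - 1\<close> with r = \<open>q ^ gcd a b\<close> leaves coprime cofactors s and t. Hence
  \<open>gcd s (2 * t)\<close> is \<open>gcd s 2\<close>, and s is a geometric sum in r whose parity
  is that of its number of terms.\<close>

lemma gcd_power_diff_one_twice:
  fixes q :: nat
  assumes "odd q" "1 < q" "0 < a" "0 < b"
  shows "gcd (q ^ a - 1) (2 * (q ^ b - 1)) =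
    (if even (a div gcd a b) then 2 else 1) * (q ^ gcd a b - 1)"
proof -
  define g where "g = gcd a b"
  define r where "r = q ^ g"
  have g: "0 < g" using assms by (simp add: g_def)
  then have r: "odd r" "1 < r" unfolding r_def using assms one_less_power[OF assms(2) g] by auto
  have dvd: "r - 1 dvd q ^ a - 1" "r - 1 dvd q ^ b - 1"
    unfolding r_def g_def using assms by (simp_all only: power_diff_one_dvd gcd_dvd1 gcd_dvd2)
  then obtain s t where s: "q ^ a - 1 = (r - 1) * s" and t: "q ^ b - 1 = (r - 1) * t" by blast
  have "(r - 1) * gcd s t = (r - 1) * 1"
    using gcd_power_diff_one[of q a b] assms unfolding s t gcd_mult_distrib_nat[symmetric]
    by (simp add: r_def g_def)
  then have "coprime s t" using r by (simp add: coprime_iff_gcd_eq_1)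
  have "q ^ a = r ^ (a div g)" by (simp add: r_def g_def flip: power_mult)
  then have "s = (r ^ (a div g) - 1) div (r - 1)" using s r by simp
  then have even_s: "even s \<longleftrightarrow> even (a div g)" using even_geometric_quotient[OF r] by simp
  have "gcd (q ^ a - 1) (2 * (q ^ b - 1)) = (r - 1) * gcd s (2 * t)"
    unfolding s t gcd_mult_distrib_nat by (simp only: mult.left_commute)
  also have "gcd s (2 * t) = gcd s 2"
    using \<open>coprime s t\<close> by (rule gcd_mult_right_right_cancel)
  also have "gcd s 2 = (if even (a div g) then 2 else 1)"
    using even_s gcd_nat.absorb2[of 2 s] by (auto simp: coprime_iff_gcd_eq_1[symmetric])
  finally show ?thesis by (simp add: r_def g_def mult.commute)
qed

text \<open>Lets the order of a stabilizer determine the pair (c, g). The mixed case would give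
  \<open>2 * q ^ g = q ^ g' + 1\<close>, which fails modulo q.\<close>

lemma scaled_power_diff_one_eq_iff:
  fixes q c c' :: nat
  assumes "2 < q" "0 < g" "0 < g'" "c \<in> {1, 2}" "c' \<in> {1, 2}"
  shows "c * (q ^ g - 1) = c' * (q ^ g' - 1) \<longleftrightarrow> c = c' \<and> g = g'"
proof -
  have neq: "2 * (q ^ g - 1) \<noteq> q ^ g' - 1" if "0 < g" "0 < g'" for g g'
  proof
    assume eq: "2 * (q ^ g - 1) = q ^ g' - 1"
    have "1 \<le> q ^ g" "1 \<le> q ^ g'" using assms(1) by simp_all
    then have "2 * q ^ g = q ^ g' + 1" using eq by linarith
    moreover have "q dvd 2 * q ^ g" "q dvd q ^ g'" using that by (auto intro: dvd_mult dvd_power)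
    ultimately have "q dvd 1" by (metis dvd_add_right_iff)
    then show False using assms(1) by simp
  qed
  have "q ^ g - 1 = q ^ g' - 1 \<longleftrightarrow> g = g'"
  proof -
    have "1 \<le> q ^ g" "1 \<le> q ^ g'" using assms(1) by simp_all
    then have "q ^ g - 1 = q ^ g' - 1 \<longleftrightarrow> q ^ g = q ^ g'" by linarith
    then show ?thesis using assms(1) by simp
  qed
  then show ?thesis using neq[of g g'] neq[of g' g] assms(2-5) by auto
qed

lemma divisors_prime_mult:
  fixes u v :: nat
  assumes "prime u" "prime v"
  shows "{d. d dvd u * v} = {1, u, v, u * v}"
proof (intro equalityI subsetI)
  fix d assume "d \<in> {d. d dvd u * v}"
  then have "d dvd u * v" by simp
  then obtain a b where "d = a * b" "a dvd u" "b dvd v" by (rule dvd_productE)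
  moreover from this have "a \<in> {1, u}" "b \<in> {1, v}" using assms by (auto simp: prime_nat_iff)
  ultimately show "d \<in> {1, u, v, u * v}" by auto
qed auto

section \<open>Subfields of a finite field and stabilizers\<close>

text \<open>Fixed points of an iterate of Frobenius; for d dividing n this is the subfield with
  \<open>p ^ d\<close> elements.\<close>

definition fixed_field :: "nat \<Rightarrow> nat \<Rightarrow> 'a :: field set" where
  "fixed_field p d = {x. x ^ (p ^ d) = x}"

definition stabilizer :: "'a :: field set \<Rightarrow> 'a set" where
  "stabilizer W = {x. \<forall>w\<in>W. x * w \<in> W}"

lemma of_nat_mem_subfield_set:
  assumes "subfield_set K"
  shows "of_nat k \<in> K"
proof (induction k)
  case 0
  show ?case using assms by (simp add: subfield_set_def)
next
  case (Suc k)
  then have "1 + of_nat k \<in> K" using assms unfolding subfield_set_def by blast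
  then show ?case by simp
qed

locale primitive_field =
  fixes p n N :: nat and \<alpha> :: "'a :: {field, finite}"
  assumes prime_p: "prime p" and odd_p: "odd p"
    and card_UNIV: "CARD('a) = p ^ n"
    and N_def: "N = p ^ n - 1"
    and primitive: "primitive_element \<alpha>"
begin

lemma p_gt_2: "2 < p"
  using prime_ge_2_nat[OF prime_p] odd_p by (cases "p = 2") auto

lemma n_pos: "0 < n"
proof (rule ccontr)
  assume "\<not> 0 < n"
  then have "CARD('a) = 1" using card_UNIV by simp
  moreover have "card {0 :: 'a, 1} \<le> CARD('a)" by (intro card_mono) auto
  ultimately show False by simp
qed

lemma power_p_gt_1: "0 < d \<Longrightarrow> 1 < p ^ d"
  using p_gt_2 by (intro one_less_power) auto

lemma N_pos: "0 < N"
  using power_p_gt_1[OF n_pos] by (simp add: N_def)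

lemma card_nonzero: "card (UNIV - {0 :: 'a}) = N"
  by (simp add: card_Diff_subset card_UNIV N_def)

lemma nonzero_eq_power:
  assumes "x \<noteq> 0"
  obtains j where "x = \<alpha> ^ j"
  using assms primitive unfolding primitive_element_def by blast

lemma alpha_power_nonzero: "\<alpha> ^ j \<noteq> 0"
  using primitive unfolding primitive_element_def by blast

lemma alpha_nonzero: "\<alpha> \<noteq> 0"
  using alpha_power_nonzero[of 1] by simp

text \<open>\<open>primitive_element\<close> says only that the powers exhaust the nonzero elements.
  The least period t of the powers makes the first t of them distinct and exhaustive, so t equals
  the number N of nonzero elements.\<close>

lemma alpha_power_eq_1_iff: "\<alpha> ^ j = 1 \<longleftrightarrow> N dvd j"
proof -
  let ?P = "\<lambda>t. 0 < t \<and> \<alpha> ^ t = 1"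
  have cancel: "\<alpha> ^ (j - i) = 1" if "\<alpha> ^ i = \<alpha> ^ j" "i \<le> j" for i j
  proof -
    have "\<alpha> ^ i * \<alpha> ^ (j - i) = \<alpha> ^ j" using that(2) by (simp flip: power_add)
    also have "\<dots> = \<alpha> ^ i * 1" using that(1) by simp
    finally show ?thesis using alpha_power_nonzero[of i] by (simp only: mult_cancel_left) simp
  qed
  \<comment> \<open>An infinite exponent set maps to a finite field, so some power repeats and a
    period exists.\<close>
  have "\<not> inj (\<lambda>k. \<alpha> ^ k)"
    using finite_imageD[of "\<lambda>k. \<alpha> ^ k" UNIV] infinite_UNIV_nat by auto
  then obtain i j where "\<alpha> ^ i = \<alpha> ^ j" "i < j"
    unfolding inj_on_def by (metis linorder_neqE_nat)
  then have ex: "?P (j - i)" using cancel[of i j] by simp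
  define t where "t = (LEAST t. ?P t)"
  have t: "0 < t" "\<alpha> ^ t = 1" using LeastI[of ?P, OF ex] by (auto simp: t_def)
  have least: "t \<le> k" if "0 < k" "\<alpha> ^ k = 1" for k
    unfolding t_def using that by (intro Least_le) auto
  have mod: "\<alpha> ^ k = \<alpha> ^ (k mod t)" for k
  proof -
    have "\<alpha> ^ k = \<alpha> ^ (t * (k div t) + k mod t)" by simp
    then show ?thesis using t by (simp only: power_add power_mult) simp
  qed
  have inj: "inj_on (\<lambda>k. \<alpha> ^ k) {..<t}"
  proof (rule linorder_inj_onI)
    fix i j assume "i < j" "i \<in> {..<t}" "j \<in> {..<t}"
    then show "\<alpha> ^ i \<noteq> \<alpha> ^ j" using cancel[of i j] least[of "j - i"] by auto
  qed auto
  have "UNIV - {0} = (\<lambda>k. \<alpha> ^ k) ` {..<t}"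
  proof -
    have "\<alpha> ^ k \<in> (\<lambda>k. \<alpha> ^ k) ` {..<t}" for k
      using mod[of k] t(1) by (intro image_eqI[of _ _ "k mod t"]) auto
    then have "range (\<lambda>k. \<alpha> ^ k) = (\<lambda>k. \<alpha> ^ k) ` {..<t}"
      by (intro subset_antisym image_subsetI image_mono) auto
    then show ?thesis using primitive unfolding primitive_element_def by (simp only:)
  qed
  then have "N = t" using card_image[OF inj] card_nonzero by simp
  have "\<alpha> ^ j = 1 \<longleftrightarrow> j mod t = 0" for j
  proof -
    have "\<not> t \<le> j mod t" using t(1) by (simp add: not_le)
    then show ?thesis using mod[of j] least[of "j mod t"] by (cases "j mod t = 0") auto
  qed
  then show ?thesis using \<open>N = t\<close> by (simp add: dvd_eq_mod_eq_0)
qed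

lemma power_N:
  fixes x :: 'a
  assumes "x \<noteq> 0"
  shows "x ^ N = 1"
proof -
  obtain j where "x = \<alpha> ^ j" using assms by (rule nonzero_eq_power)
  then have "x ^ N = \<alpha> ^ (j * N)" by (simp add: power_mult)
  then show ?thesis using alpha_power_eq_1_iff[of "j * N"] by simp
qed

lemma power_p_n: "x ^ (p ^ n) = x" for x :: 'a
proof (cases "x = 0")
  case False
  have "p ^ n = Suc N" using power_p_gt_1[OF n_pos] by (simp add: N_def)
  then show ?thesis using power_N[OF False] by simp
qed (use prime_p in \<open>simp add: prime_gt_0_nat\<close>)

text \<open>Closure under products thereby yields closure under inverses.\<close>

lemma inverse_eq_power:
  fixes x :: 'a
  assumes "x \<noteq> 0"
  shows "inverse x = x ^ (N - 1)"
proof -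
  have "x * x ^ (N - 1) = x ^ Suc (N - 1)" by simp
  also have "\<dots> = 1" using power_N[OF assms] N_pos by simp
  finally have "x * x ^ (N - 1) = x * inverse x" by (simp only: right_inverse[OF assms])
  then show ?thesis by (rule mult_left_cancel[OF assms, THEN iffD1, symmetric])
qed

lemma alpha_power_root_iff:
  assumes "N = L * e"
  shows "(\<alpha> ^ j) ^ e = 1 \<longleftrightarrow> L dvd j"
proof -
  have "e \<noteq> 0" using assms N_pos by auto
  then show ?thesis
    using alpha_power_eq_1_iff[of "j * e"] assms by (simp add: power_mult)
qed

text \<open>The roots are the powers of \<open>\<alpha> ^ (N div e)\<close>. A consequence used
  throughout: for divisors of N, the set of e-th roots of unity determines e.\<close>

lemma card_roots:
  assumes "e dvd N"
  shows "card {x :: 'a. x ^ e = 1} = e"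
proof -
  obtain L where N: "N = L * e" using assms by (metis dvd_div_mult_self)
  have L: "0 < L" and e: "0 < e" using N N_pos by auto
  have "{x :: 'a. x ^ e = 1} = (\<lambda>i. \<alpha> ^ (L * i)) ` {..<e}"
  proof (intro equalityI subsetI)
    fix x :: 'a assume x: "x \<in> {x. x ^ e = 1}"
    then have "x \<noteq> 0" using e by (auto simp: power_0_left)
    then obtain j where j: "x = \<alpha> ^ j" by (rule nonzero_eq_power)
    then obtain k where k: "j = L * k" using x alpha_power_root_iff[OF N] by auto
    have "x = \<alpha> ^ (L * (k mod e))"
    proof -
      have "L * k = N * (k div e) + L * (k mod e)"
        unfolding N by (metis distrib_left mult.assoc mult_div_mod_eq)
      then have "x = (\<alpha> ^ N) ^ (k div e) * \<alpha> ^ (L * (k mod e))"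
        by (simp only: j k power_add power_mult)
      then show ?thesis using power_N[OF alpha_nonzero] by simp
    qed
    then show "x \<in> (\<lambda>i. \<alpha> ^ (L * i)) ` {..<e}" using e by auto
  next
    fix x assume "x \<in> (\<lambda>i. \<alpha> ^ (L * i)) ` {..<e}"
    then obtain i where "x = \<alpha> ^ (L * i)" by blast
    then show "x \<in> {x. x ^ e = 1}" using alpha_power_root_iff[OF N, of "L * i"] by simp
  qed
  moreover have "inj_on (\<lambda>i. \<alpha> ^ (L * i)) {..<e}"
  proof (rule linorder_inj_onI)
    fix i j assume ij: "i < j" "i \<in> {..<e}" "j \<in> {..<e}"
    show "\<alpha> ^ (L * i) \<noteq> \<alpha> ^ (L * j)"
    proof
      assume "\<alpha> ^ (L * i) = \<alpha> ^ (L * j)"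
      moreover have "\<alpha> ^ (L * j) = \<alpha> ^ (L * i) * \<alpha> ^ (L * (j - i))"
        using ij(1) by (simp flip: power_add distrib_left)
      ultimately have "\<alpha> ^ (L * (j - i)) = 1" using alpha_nonzero by simp
      then have "L * e dvd L * (j - i)" using alpha_power_eq_1_iff N by simp
      then have "e dvd j - i" using L by simp
      then show False using ij by (auto dest: dvd_imp_le)
    qed
  qed auto
  ultimately show ?thesis by (simp add: card_image)
qed

text \<open>In a finite group a product-closed set containing 1 is a subgroup, and here the group is
  cyclic: the least positive exponent l in the set generates it and divides N.\<close>

lemma mult_closed_eq_roots:
  assumes "S \<subseteq> UNIV - {0 :: 'a}" "1 \<in> S" "\<And>x y. x \<in> S \<Longrightarrow> y \<in> S \<Longrightarrow> x * y \<in> S"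
  obtains e where "e dvd N" "S = {x. x ^ e = 1}"
proof -
  have pow: "x ^ k \<in> S" if "x \<in> S" for x k
    using that assms(2,3) by (induction k) auto
  let ?P = "\<lambda>l. 0 < l \<and> \<alpha> ^ l \<in> S"
  have ex: "?P N" using N_pos assms(2) power_N[OF alpha_nonzero] by simp
  define l where "l = (LEAST l. ?P l)"
  have l: "0 < l" "\<alpha> ^ l \<in> S" using LeastI[of ?P, OF ex] by (auto simp: l_def)
  have least: "l \<le> k" if "0 < k" "\<alpha> ^ k \<in> S" for k
    unfolding l_def using that by (intro Least_le) auto
  have iff: "\<alpha> ^ j \<in> S \<longleftrightarrow> l dvd j" for j
  proof
    assume j: "\<alpha> ^ j \<in> S"
    \<comment> \<open>Raising to \<open>N - 1\<close> inverts, so this subtracts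
      \<open>l * (j div l)\<close> from the exponent using products alone.\<close>
    have "\<alpha> ^ j * (\<alpha> ^ l) ^ (j div l * (N - 1)) = \<alpha> ^ (j mod l) * (\<alpha> ^ N) ^ (l * (j div l))"
    proof -
      have "j + l * (j div l * (N - 1)) = j mod l + l * (j div l) * (1 + (N - 1))"
        by (simp add: algebra_simps)
      also have "\<dots> = j mod l + N * (l * (j div l))" using N_pos by simp
      finally show ?thesis by (simp flip: power_mult power_add)
    qed
    then have "\<alpha> ^ (j mod l) = \<alpha> ^ j * (\<alpha> ^ l) ^ (j div l * (N - 1))"
      using power_N[OF alpha_nonzero] by simp
    then have "\<alpha> ^ (j mod l) \<in> S" using assms(3)[OF j pow[OF l(2)]] by simp
    then show "l dvd j" using least[of "j mod l"] mod_less_divisor[OF l(1), of j]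
      by (cases "j mod l = 0") auto
  next
    assume "l dvd j"
    then show "\<alpha> ^ j \<in> S" using pow[OF l(2)] by (auto simp: power_mult)
  qed
  then have "l dvd N" using ex by blast
  then obtain e where N: "N = l * e" by blast
  have "S = {x. x ^ e = 1}"
  proof (intro Set.set_eqI)
    fix x
    show "x \<in> S \<longleftrightarrow> x \<in> {x. x ^ e = 1}"
    proof (cases "x = 0")
      case True
      then show ?thesis using assms(1) N N_pos by (auto simp: power_0_left)
    next
      case False
      then obtain j where "x = \<alpha> ^ j" by (rule nonzero_eq_power)
      then show ?thesis using iff alpha_power_root_iff[OF N] by simp
    qed
  qed
  moreover have "e dvd N" using N by simp
  ultimately show ?thesis by (rule that[rotated])
qed

lemma CHAR_eq: "CHAR('a) = p"
proof -
  have "CHAR('a) dvd p ^ n" using CHAR_dvd_CARD[where 'a = 'a] card_UNIV by simp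
  then obtain k where "CHAR('a) = p ^ k" using divides_primepow_nat[OF prime_p] by blast
  moreover have "prime CHAR('a)" by (intro prime_CHAR_semidom finite_imp_CHAR_pos) auto
  ultimately show ?thesis by (metis prime_power_iff power_one_right)
qed

lemma frobenius_add: "(x + y) ^ (p ^ i) = x ^ (p ^ i) + y ^ (p ^ i)" for x y :: 'a
  by (rule freshmans_dream'[where n = i]) (simp_all add: CHAR_eq prime_p)

lemma power_p_ne_0: "p ^ i \<noteq> 0"
  using p_gt_2 by simp

lemma subfield_set_fixed_field: "subfield_set (fixed_field p d :: 'a set)"
proof -
  have "(- x) ^ (p ^ d) = - x" if "x ^ (p ^ d) = x" for x :: 'a
  proof -
    have "x ^ (p ^ d) + (- x) ^ (p ^ d) = 0"
      using frobenius_add[of x "- x" d] power_p_ne_0[of d] by (simp add: zero_power)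
    then have "x + (- x) ^ (p ^ d) = 0" using that by simp
    then show ?thesis by (rule minus_unique[symmetric])
  qed
  then show ?thesis
    by (auto simp: subfield_set_def fixed_field_def frobenius_add power_mult_distrib power_inverse
        power_0_left p_gt_2[THEN gr_implies_not0])
qed

lemma fixed_field_nonzero: "fixed_field p d - {0 :: 'a} = {x. x ^ (p ^ d - 1) = 1} - {0}"
proof -
  have "x ^ (p ^ d) = x \<longleftrightarrow> x ^ (p ^ d - 1) = 1" if "x \<noteq> 0" for x :: 'a
  proof -
    have "x ^ (p ^ d) = x * x ^ (p ^ d - 1)"
      using power_p_ne_0[of d] by (cases "p ^ d") auto
    then show ?thesis using that by (simp only:) simp
  qed
  then show ?thesis unfolding fixed_field_def by blast
qed

lemma fixed_field_mono:
  assumes "d dvd d'" "0 < d"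
  shows "fixed_field p d \<subseteq> (fixed_field p d' :: 'a set)"
proof
  fix x :: 'a assume x: "x \<in> fixed_field p d"
  obtain k where "d' = d * k" using assms by blast
  have "x ^ ((p ^ d) ^ k) = x" for k
  proof (induction k)
    case (Suc k)
    have "x ^ ((p ^ d) ^ Suc k) = (x ^ (p ^ d)) ^ ((p ^ d) ^ k)" by (simp only: power_Suc power_mult)
    then show ?case using Suc x by (simp add: fixed_field_def)
  qed simp
  then show "x \<in> fixed_field p d'" using \<open>d' = d * k\<close> by (simp add: fixed_field_def power_mult)
qed

lemma card_fixed_field:
  assumes "d dvd n"
  shows "card (fixed_field p d :: 'a set) = p ^ d"
proof -
  have d: "0 < d" using assms n_pos by (auto intro: dvd_pos_nat)
  have "0 \<in> (fixed_field p d :: 'a set)" using subfield_set_fixed_field by (auto simp: subfield_set_def)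
  moreover have "{x :: 'a. x ^ (p ^ d - 1) = 1} - {0} = {x. x ^ (p ^ d - 1) = 1}"
    using power_p_gt_1[OF d] by (auto simp: power_0_left)
  ultimately have "fixed_field p d = insert 0 {x :: 'a. x ^ (p ^ d - 1) = 1}"
    using fixed_field_nonzero[of d] by blast
  moreover have "p ^ d - 1 dvd N" unfolding N_def by (rule power_diff_one_dvd[OF assms]) (use p_gt_2 in simp)
  ultimately show ?thesis
    using card_roots[of "p ^ d - 1"] power_p_gt_1[OF d] by (simp add: power_0_left)
qed

text \<open>The left side lies in the right, which has p elements, and characteristic p keeps the
  images of the first p naturals distinct.\<close>

lemma prime_subfield_eq: "prime_subfield = (fixed_field p 1 :: 'a set)"
proof (rule card_subset_eq)
  show sub: "prime_subfield \<subseteq> (fixed_field p 1 :: 'a set)"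
    unfolding prime_subfield_def
    by (rule image_subsetI) (rule of_nat_mem_subfield_set[OF subfield_set_fixed_field])
  have "inj_on (of_nat :: nat \<Rightarrow> 'a) {..<p}"
    unfolding inj_on_def of_nat_eq_iff_cong_CHAR CHAR_eq cong_def by simp
  then have "p \<le> card (prime_subfield :: 'a set)"
    using card_mono[of "prime_subfield :: 'a set" "of_nat ` {..<p}"]
    by (simp add: card_image prime_subfield_def image_mono)
  moreover have "card (prime_subfield :: 'a set) \<le> card (fixed_field p 1 :: 'a set)"
    by (rule card_mono[OF _ sub]) simp
  moreover have "card (fixed_field p 1 :: 'a set) = p" using card_fixed_field[of 1] by simp
  ultimately show "card (prime_subfield :: 'a set) = card (fixed_field p 1 :: 'a set)" by simp
qed simp

text \<open>\<open>K\<close> is a space over the prime field, so it has \<open>p ^ d\<close>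
  elements, and the whole field is a space over \<open>K\<close>, so d divides n. The nonzero part
  of \<open>K\<close> is a group of roots of unity of order \<open>p ^ d - 1\<close>, which leaves
  only one candidate.\<close>

lemma subfield_set_eq_fixed_field:
  assumes K: "subfield_set (K :: 'a set)"
  obtains d where "d dvd n" "K = fixed_field p d"
proof -
  have "fixed_field p 1 \<subseteq> K"
    unfolding prime_subfield_eq[symmetric] prime_subfield_def
    by (rule image_subsetI) (rule of_nat_mem_subfield_set[OF K])
  then have "subspace_over (fixed_field p 1) K"
    using K by (auto simp: subspace_over_def subfield_set_def)
  then obtain d where d: "card K = p ^ d"
    using card_subspace_over[OF subfield_set_fixed_field[of 1], of K] card_fixed_field[of 1] by auto
  obtain m where "p ^ n = (p ^ d) ^ m"
    using card_subspace_over[OF K, of UNIV] card_UNIV d by (auto simp: subspace_over_def)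
  then have "n = d * m" using p_gt_2 by (simp flip: power_mult)
  then have dn: "d dvd n" by simp
  have d0: "0 < d" using dn n_pos by (auto intro: dvd_pos_nat)
  have 0: "0 \<in> K" using K by (simp add: subfield_set_def)
  obtain e where e: "e dvd N" "K - {0} = {x. x ^ e = 1}"
    using mult_closed_eq_roots[of "K - {0}"] K by (auto simp: subfield_set_def)
  have "card (K - {0}) = p ^ d - 1" using 0 d by (simp add: card_Diff_subset)
  then have "e = p ^ d - 1" using card_roots[OF e(1)] e(2) by simp
  then have "K - {0} = fixed_field p d - {0}"
    using e(2) fixed_field_nonzero[of d] by auto
  then have "K = fixed_field p d"
    using 0 subfield_set_fixed_field[of d] by (auto simp: subfield_set_def)
  then show ?thesis using that dn by blast
qed

text \<open>A larger field is a vector space over the smaller one, so its size is a power of the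
  smaller size.\<close>

lemma fixed_field_subset_iff:
  assumes "d dvd n" "d' dvd n"
  shows "fixed_field p d \<subseteq> (fixed_field p d' :: 'a set) \<longleftrightarrow> d dvd d'"
proof
  assume "fixed_field p d \<subseteq> (fixed_field p d' :: 'a set)"
  then have "subspace_over (fixed_field p d) (fixed_field p d' :: 'a set)"
    using subfield_set_fixed_field[of d'] by (auto simp: subspace_over_def subfield_set_def)
  then obtain k where "p ^ d' = (p ^ d) ^ k"
    using card_subspace_over[OF subfield_set_fixed_field[of d]] card_fixed_field assms by metis
  then show "d dvd d'" using p_gt_2 by (simp flip: power_mult)
next
  assume "d dvd d'"
  then show "fixed_field p d \<subseteq> (fixed_field p d' :: 'a set)"
    using assms n_pos by (intro fixed_field_mono) (auto intro: dvd_pos_nat)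
qed

lemma subspace_over_iff_stabilizer:
  "subspace_over K W \<longleftrightarrow> 0 \<in> W \<and> (\<forall>x\<in>W. \<forall>y\<in>W. x + y \<in> W) \<and> K \<subseteq> stabilizer W"
  by (auto simp: subspace_over_def stabilizer_def)

text \<open>Sums and products are immediate, 0 and -1 come from the prime field acting on
  \<open>W\<close>, and inverses are powers.\<close>

lemma subfield_set_stabilizer:
  assumes W: "subspace_over prime_subfield (W :: 'a set)"
  shows "subfield_set (stabilizer W)"
proof -
  have mult: "x * y \<in> stabilizer W" if "x \<in> stabilizer W" "y \<in> stabilizer W" for x y
    using that by (simp add: stabilizer_def mult.assoc)
  have one: "1 \<in> stabilizer W" by (simp add: stabilizer_def)
  have pow: "x ^ k \<in> stabilizer W" if "x \<in> stabilizer W" for x k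
    using that mult one by (induction k) auto
  have prime_sub: "prime_subfield \<subseteq> stabilizer W" using W by (simp add: subspace_over_iff_stabilizer)
  moreover have "0 \<in> (prime_subfield :: 'a set)" "- 1 \<in> (prime_subfield :: 'a set)"
    using subfield_set_fixed_field[of 1] unfolding prime_subfield_eq subfield_set_def by blast+
  ultimately have zero: "0 \<in> stabilizer W" and m1: "- 1 \<in> stabilizer W" by auto
  have "- x \<in> stabilizer W" if "x \<in> stabilizer W" for x
    using mult[OF m1 that] by simp
  moreover have "inverse x \<in> stabilizer W" if "x \<in> stabilizer W" for x
    using pow[OF that] zero inverse_eq_power[of x] by (cases "x = 0") auto
  moreover have "x + y \<in> stabilizer W" if "x \<in> stabilizer W" "y \<in> stabilizer W" for x y
    using that W by (simp add: stabilizer_def subspace_over_def distrib_right)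
  ultimately show ?thesis using zero one mult by (simp add: subfield_set_def)
qed

end

text \<open>Zero is left out, unlike in \<open>stabilizer\<close>, to obtain a group of roots of
  unity. Because of the square, adding 0 need not give a subfield.\<close>

definition weighted_stabilizer :: "('a :: field \<times> 'a) set \<Rightarrow> 'a set" where
  "weighted_stabilizer W = {x. x \<noteq> 0 \<and> (\<forall>(a, b)\<in>W. (x * a, x\<^sup>2 * b) \<in> W)}"

section \<open>Counting subspaces and pairs of subspaces by their exact stabilizers\<close>

context primitive_field
begin

definition stab_count :: "nat \<Rightarrow> nat" where
  "stab_count d = card {W :: 'a set. subspace_over prime_subfield W \<and> stabilizer W = fixed_field p d}"

lemma fixed_field_inj:
  assumes "d dvd n" "d' dvd n" "fixed_field p d = (fixed_field p d' :: 'a set)"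
  shows "d = d'"
proof -
  have "p ^ d = p ^ d'" using card_fixed_field[OF assms(1)] card_fixed_field[OF assms(2)] assms(3) by simp
  then show ?thesis using p_gt_2 by simp
qed

lemma finite_divisors_n: "finite {d. d dvd n}"
  using n_pos by simp

text \<open>A subspace over the field with \<open>p ^ d\<close> elements is one whose stabilizer
  contains that field, so sorting by exact stabilizer runs over d' with d | d' | n. Read from d = n
  downwards, these equations form a triangular system for \<open>stab_count\<close>. The added 1 is
  the zero subspace.\<close>

lemma sum_stab_count:
  assumes "d dvd n"
  shows "(\<Sum>d' | d' dvd n \<and> d dvd d'. real (stab_count d')) = num_subspaces (n div d) (p ^ d) + 1"
proof -
  let ?S = "\<lambda>d. {W :: 'a set. subspace_over prime_subfield W \<and> stabilizer W = fixed_field p d}"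
  let ?D = "{d'. d' dvd n \<and> d dvd d'}"
  have fin: "finite ?D" using finite_divisors_n by (rule finite_subset[rotated]) auto
  have sub: "subspace_over (fixed_field p d) W \<longleftrightarrow> W \<in> (\<Union>d'\<in>?D. ?S d')" for W :: "'a set"
  proof
    assume W: "subspace_over (fixed_field p d) W"
    have "fixed_field p 1 \<subseteq> (fixed_field p d :: 'a set)"
      using fixed_field_subset_iff[of 1 d] assms by simp
    then have PW: "subspace_over prime_subfield W"
      using W unfolding prime_subfield_eq subspace_over_iff_stabilizer by blast
    obtain d' where d': "d' dvd n" "stabilizer W = fixed_field p d'"
      using subfield_set_eq_fixed_field[OF subfield_set_stabilizer[OF PW]] by blast
    then have "d dvd d'"
      using W fixed_field_subset_iff[OF assms d'(1)] by (simp add: subspace_over_iff_stabilizer)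
    then show "W \<in> (\<Union>d'\<in>?D. ?S d')" using d' PW by blast
  next
    assume "W \<in> (\<Union>d'\<in>?D. ?S d')"
    then obtain d' where d': "d' dvd n" "d dvd d'" "subspace_over prime_subfield W"
      "stabilizer W = fixed_field p d'" by blast
    then show "subspace_over (fixed_field p d) W"
      using fixed_field_subset_iff[OF assms d'(1)] by (simp add: subspace_over_iff_stabilizer)
  qed
  have "card {W :: 'a set. subspace_over (fixed_field p d) W} = card (\<Union>d'\<in>?D. ?S d')"
    by (rule arg_cong[where f = card]) (use sub in blast)
  also have "\<dots> = (\<Sum>d'\<in>?D. stab_count d')"
    unfolding stab_count_def
  proof (rule card_UN_disjoint[OF fin])
    show "\<forall>i\<in>?D. \<forall>j\<in>?D. i \<noteq> j \<longrightarrow> ?S i \<inter> ?S j = {}"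
      using fixed_field_inj by blast
  qed simp
  finally have "real (card {W :: 'a set. subspace_over (fixed_field p d) W}) = (\<Sum>d'\<in>?D. real (stab_count d'))"
    by simp
  moreover have "CARD('a) = card (fixed_field p d :: 'a set) ^ (n div d)"
    using assms by (simp add: card_UNIV card_fixed_field flip: power_mult)
  ultimately show ?thesis
    using card_subspaces[OF subfield_set_fixed_field[of d]] assms by (simp add: card_fixed_field)
qed

text \<open>With x = \<open>\<alpha> ^ j\<close> each condition says that N divides a multiple of
  j.\<close>

lemma roots_gcd:
  assumes "x \<noteq> (0 :: 'a)"
  shows "x ^ gcd a b = 1 \<longleftrightarrow> x ^ a = 1 \<and> x ^ b = 1"
proof -
  obtain j where "x = \<alpha> ^ j" using assms by (rule nonzero_eq_power)
  then have "x ^ k = 1 \<longleftrightarrow> N dvd j * k" for k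
    using alpha_power_eq_1_iff[of "j * k"] by (simp add: power_mult)
  moreover have "N dvd j * gcd a b \<longleftrightarrow> N dvd j * a \<and> N dvd j * b"
    unfolding gcd_mult_distrib_nat by (rule gcd_greatest_iff)
  ultimately show ?thesis by (simp only:)
qed

lemma mem_fixed_field_iff: "x \<noteq> 0 \<Longrightarrow> x \<in> fixed_field p d \<longleftrightarrow> x ^ (p ^ d - 1) = 1" for x :: 'a
  using fixed_field_nonzero[of d] by blast

text \<open>Since both factors contain 0, testing on pairs (a, 0) and (0, b) separates the two
  conditions.\<close>

lemma weighted_stabilizer_Times:
  assumes "0 \<in> W" "0 \<in> W'"
  shows "weighted_stabilizer (W \<times> W') = {x. x \<noteq> 0 \<and> x \<in> stabilizer W \<and> x\<^sup>2 \<in> stabilizer W'}"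
  using assms unfolding weighted_stabilizer_def stabilizer_def by blast

text \<open>For nonzero x, membership of x in the first field is \<open>x ^ (p ^ d - 1) = 1\<close>
  and membership of x^2 in the second is \<open>x ^ (2 * (p ^ d' - 1)) = 1\<close>;
  \<open>roots_gcd\<close> merges the two equations.\<close>

lemma weighted_stabilizer_Times_eq_roots:
  assumes "d dvd n" "d' dvd n" "0 \<in> (W :: 'a set)" "0 \<in> W'"
    and "stabilizer W = fixed_field p d" "stabilizer W' = fixed_field p d'"
  shows "weighted_stabilizer (W \<times> W') = {x. x ^ gcd (p ^ d - 1) (2 * (p ^ d' - 1)) = 1}"
proof -
  have "0 < d" using assms n_pos by (auto intro: dvd_pos_nat)
  then have pos: "0 < gcd (p ^ d - 1) (2 * (p ^ d' - 1))" using power_p_gt_1[of d] by simp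
  have "x \<in> stabilizer W \<and> x\<^sup>2 \<in> stabilizer W' \<longleftrightarrow> x ^ gcd (p ^ d - 1) (2 * (p ^ d' - 1)) = 1"
    if "x \<noteq> 0" for x
    using that roots_gcd[OF that] mem_fixed_field_iff[of "x\<^sup>2" d'] mem_fixed_field_iff[OF that, of d] assms
    by (simp add: power_mult)
  moreover have "(0 :: 'a) ^ gcd (p ^ d - 1) (2 * (p ^ d' - 1)) \<noteq> 1" using pos by (simp add: zero_power)
  ultimately have "x \<noteq> 0 \<and> x \<in> stabilizer W \<and> x\<^sup>2 \<in> stabilizer W' \<longleftrightarrow>
      x ^ gcd (p ^ d - 1) (2 * (p ^ d' - 1)) = 1" for x
    by (cases "x = 0") auto
  then show ?thesis unfolding weighted_stabilizer_Times[OF assms(3,4)] by (simp only:)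
qed

definition subspace_pairs :: "nat \<Rightarrow> ('a set \<times> 'a set) set" where
  "subspace_pairs e = {(W, W'). subspace_over prime_subfield W \<and> subspace_over prime_subfield W' \<and>
     weighted_stabilizer (W \<times> W') = {x. x ^ e = 1}}"

text \<open>Each factor has a unique stabilizer degree, and the degrees (d, d') alone decide whether
  the pair belongs, so the set is a disjoint union of products of the classes counted by
  \<open>stab_count\<close>.\<close>

lemma card_subspace_pairs:
  assumes "e dvd N"
  shows "card (subspace_pairs e) =
    (\<Sum>(d, d') | d dvd n \<and> d' dvd n \<and> gcd (p ^ d - 1) (2 * (p ^ d' - 1)) = e. stab_count d * stab_count d')"
proof -
  let ?S = "\<lambda>d. {W :: 'a set. subspace_over prime_subfield W \<and> stabilizer W = fixed_field p d}"
  let ?h = "\<lambda>d d'. gcd (p ^ d - 1) (2 * (p ^ d' - 1))"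
  let ?D = "{(d, d'). d dvd n \<and> d' dvd n \<and> ?h d d' = e}"
  have fin: "finite ?D"
    by (rule finite_subset[of _ "{d. d dvd n} \<times> {d. d dvd n}"]) (use finite_divisors_n in auto)
  have iff: "weighted_stabilizer (W \<times> W') = {x. x ^ e = 1} \<longleftrightarrow> ?h d d' = e"
    if d: "d dvd n" "d' dvd n" and W: "W \<in> ?S d" "W' \<in> ?S d'" for d d' W W'
  proof -
    have eq: "weighted_stabilizer (W \<times> W') = {x. x ^ ?h d d' = 1}"
      using W by (intro weighted_stabilizer_Times_eq_roots d) (auto simp: subspace_over_def)
    have "?h d d' dvd N" unfolding N_def using power_diff_one_dvd[OF d(1), of p] p_gt_2 by (auto intro: dvd_trans[OF gcd_dvd1])
    \<comment> \<open>Both exponents divide N, so equal root sets force equal exponents by counting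
      roots.\<close>
    then have "{x :: 'a. x ^ ?h d d' = 1} = {x. x ^ e = 1} \<longleftrightarrow> ?h d d' = e"
      using card_roots assms by metis
    then show ?thesis unfolding eq .
  qed
  have ex: "\<exists>d. d dvd n \<and> W \<in> ?S d" if "subspace_over prime_subfield W" for W :: "'a set"
    using subfield_set_eq_fixed_field[OF subfield_set_stabilizer[OF that]] that by blast
  have "subspace_pairs e = (\<Union>(d, d')\<in>?D. ?S d \<times> ?S d')"
  proof (intro equalityI subsetI)
    fix z assume z: "z \<in> subspace_pairs e"
    obtain W W' where zW: "z = (W, W')" by (cases z)
    with z have W: "subspace_over prime_subfield W" "subspace_over prime_subfield W'"
      "weighted_stabilizer (W \<times> W') = {x. x ^ e = 1}"
      by (auto simp: subspace_pairs_def)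
    from ex[OF W(1)] ex[OF W(2)] obtain d d' where d: "d dvd n" "W \<in> ?S d" "d' dvd n" "W' \<in> ?S d'"
      by blast
    then have "(d, d') \<in> ?D" using iff[OF d(1,3,2,4)] W(3) by simp
    then show "z \<in> (\<Union>(d, d')\<in>?D. ?S d \<times> ?S d')" using d zW by blast
  next
    fix z assume "z \<in> (\<Union>(d, d')\<in>?D. ?S d \<times> ?S d')"
    then obtain d d' W W' where *: "d dvd n" "d' dvd n" "?h d d' = e" "W \<in> ?S d" "W' \<in> ?S d'" "z = (W, W')"
      by blast
    then have "weighted_stabilizer (W \<times> W') = {x. x ^ e = 1}" using iff[OF *(1,2,4,5)] by simp
    then show "z \<in> subspace_pairs e" using * by (simp add: subspace_pairs_def)
  qed
  then have "card (subspace_pairs e) = card (\<Union>z\<in>?D. case z of (d, d') \<Rightarrow> ?S d \<times> ?S d')" by simp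
  also have "\<dots> = (\<Sum>z\<in>?D. card (case z of (d, d') \<Rightarrow> ?S d \<times> ?S d'))"
  proof (rule card_UN_disjoint[OF fin])
    show "\<forall>i\<in>?D. \<forall>j\<in>?D. i \<noteq> j \<longrightarrow>
      (case i of (d, d') \<Rightarrow> ?S d \<times> ?S d') \<inter> (case j of (d, d') \<Rightarrow> ?S d \<times> ?S d') = {}"
    proof (intro ballI impI)
      fix i j assume ij: "i \<in> ?D" "j \<in> ?D" "i \<noteq> j"
      obtain a b c d where [simp]: "i = (a, b)" "j = (c, d)" by (cases i, cases j)
      have "a \<noteq> c \<or> b \<noteq> d" using ij(3) by simp
      then have "?S a \<inter> ?S c = {} \<or> ?S b \<inter> ?S d = {}"
        using ij(1,2) fixed_field_inj[of a c] fixed_field_inj[of b d] by auto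
      then show "(case i of (d, d') \<Rightarrow> ?S d \<times> ?S d') \<inter> (case j of (d, d') \<Rightarrow> ?S d \<times> ?S d') = {}"
        by auto
    qed
  qed auto
  also have "\<dots> = (\<Sum>(d, d')\<in>?D. stab_count d * stab_count d')"
    by (rule sum.cong[OF refl]) (auto simp: stab_count_def card_cartesian_product)
  finally show ?thesis .
qed

text \<open>The zero code is not a subcode here; this locates the only order at which it must be
  subtracted, namely that of the cyclic codes.\<close>

lemma zero_pair_mem_subspace_pairs_iff:
  assumes "e dvd N"
  shows "({0}, {0}) \<in> subspace_pairs e \<longleftrightarrow> e = N"
proof -
  have "weighted_stabilizer ({0} \<times> {0 :: 'a}) = UNIV - {0}" by (auto simp: weighted_stabilizer_def)
  also have "\<dots> = {x. x ^ N = 1}" using power_N N_pos by (auto simp: zero_power)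
  finally have "weighted_stabilizer ({0} \<times> {0 :: 'a}) = {x. x ^ N = 1}" .
  moreover have "{x :: 'a. x ^ N = 1} = {x. x ^ e = 1} \<longleftrightarrow> e = N"
    using card_roots[OF assms] card_roots[of N] by fastforce
  ultimately show ?thesis by (simp add: subspace_pairs_def subspace_over_def)
qed

end

section \<open>Codewords as pairs of field elements\<close>

context primitive_field
begin

lemma fixed_field_1_power: "a \<in> fixed_field p 1 \<Longrightarrow> a ^ (p ^ i) = a" for a :: 'a
  using fixed_field_mono[of 1 i] by (cases "i = 0") (auto simp: fixed_field_def)

lemma field_trace_add: "field_trace p n (x + y) = field_trace p n x + field_trace p n y" for x y :: 'a
  by (simp add: field_trace_def frobenius_add sum.distrib)

lemma field_trace_scale:
  fixes a x :: 'a
  assumes "a \<in> prime_subfield"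
  shows "field_trace p n (a * x) = a * field_trace p n x"
  using assms fixed_field_1_power[of a]
  by (simp add: field_trace_def power_mult_distrib sum_distrib_left prime_subfield_eq)

text \<open>The p-th power moves each summand to the next, and the last returns to the first because
  \<open>x ^ (p ^ n) = x\<close>.\<close>

lemma field_trace_mem: "field_trace p n x \<in> (prime_subfield :: 'a set)"
proof -
  have "prime CHAR('a)" using CHAR_eq prime_p by simp
  then have "field_trace p n x ^ p = (\<Sum>i<n. (x ^ (p ^ i)) ^ p)"
    unfolding field_trace_def by (rule freshmans_dream_sum) (simp add: CHAR_eq)
  also have "\<dots> = (\<Sum>i<n. x ^ (p ^ Suc i))"
    by (simp add: mult.commute flip: power_mult)
  also have "\<dots> = field_trace p n x"
    using sum.lessThan_Suc_shift[of "\<lambda>i. x ^ (p ^ i)" n] power_p_n[of x]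
    by (simp add: field_trace_def)
  finally show ?thesis by (simp add: prime_subfield_eq fixed_field_def)
qed

text \<open>As a polynomial in x the form has degree at most \<open>2 * p ^ (n - 1)\<close>, less
  than \<open>p ^ n\<close>, yet it vanishes on the whole field, so it is zero. Its coefficients at
  1 and 2 are l and b: for odd p, among the exponents \<open>p ^ i\<close> and
  \<open>2 * p ^ i\<close> these two values arise only at i = 0.\<close>

lemma trace_form_eq_0:
  fixes l b :: 'a
  assumes "\<And>x. x \<noteq> 0 \<Longrightarrow> field_trace p n (l * x + b * x\<^sup>2) = 0"
  shows "l = 0 \<and> b = 0"
proof -
  define P where "P = (\<Sum>i<n. Polynomial.monom (l ^ (p ^ i)) (p ^ i) + Polynomial.monom (b ^ (p ^ i)) (2 * p ^ i))"
  have "poly P x = field_trace p n (l * x + b * x\<^sup>2)" for x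
    by (simp add: P_def field_trace_def poly_sum poly_monom frobenius_add power_mult_distrib power_mult)
  \<comment> \<open>The assumption covers nonzero arguments only; the root 0 is added by hand to
    reach all \<open>p ^ n\<close> elements.\<close>
  moreover have "field_trace p n (l * 0 + b * 0\<^sup>2) = 0"
    using power_p_ne_0 by (simp add: field_trace_def zero_power)
  ultimately have roots: "{x. poly P x = 0} = UNIV" using assms by (metis (mono_tags, lifting) UNIV_eq_I mem_Collect_eq)
  have "Polynomial.degree P < p ^ n"
  proof -
    have "Polynomial.degree P \<le> 2 * p ^ (n - 1)"
      unfolding P_def
    proof (intro degree_sum_le degree_add_le)
      fix i assume "i \<in> {..<n}"
      then have "p ^ i \<le> p ^ (n - 1)" using p_gt_2 by (intro power_increasing) auto
      then show "Polynomial.degree (Polynomial.monom (l ^ (p ^ i)) (p ^ i)) \<le> 2 * p ^ (n - 1)"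
        "Polynomial.degree (Polynomial.monom (b ^ (p ^ i)) (2 * p ^ i)) \<le> 2 * p ^ (n - 1)"
        using degree_monom_le[of "l ^ (p ^ i)" "p ^ i"] degree_monom_le[of "b ^ (p ^ i)" "2 * p ^ i"]
        by linarith+
    qed simp
    also have "\<dots> < p * p ^ (n - 1)" using p_gt_2 by simp
    also have "\<dots> = p ^ n" using n_pos by (simp flip: power_Suc)
    finally show ?thesis .
  qed
  then have "P = 0" using card_poly_roots_bound[of P] roots card_UNIV by fastforce
  moreover have "Polynomial.coeff P 1 = l"
  proof -
    have "Polynomial.coeff P 1 = (\<Sum>i<n. if i = 0 then l else 0)"
      unfolding P_def Polynomial.coeff_sum
    proof (rule sum.cong[OF refl])
      fix i
      have "2 * p ^ i \<noteq> 1" by presburger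
      then show "Polynomial.coeff (Polynomial.monom (l ^ (p ^ i)) (p ^ i) + Polynomial.monom (b ^ (p ^ i)) (2 * p ^ i)) 1 = (if i = 0 then l else 0)"
        using p_gt_2 by auto
    qed
    then show ?thesis using n_pos by simp
  qed
  moreover have "Polynomial.coeff P 2 = b"
  proof -
    have "Polynomial.coeff P 2 = (\<Sum>i<n. if i = 0 then b else 0)"
      unfolding P_def Polynomial.coeff_sum
    proof (rule sum.cong[OF refl])
      fix i
      have "odd (p ^ i)" using odd_p by simp
      then have "p ^ i \<noteq> 2" by (metis dvd_refl)
      moreover have "2 * p ^ i = 2 \<longleftrightarrow> i = 0" using p_gt_2 by auto
      ultimately show "Polynomial.coeff (Polynomial.monom (l ^ (p ^ i)) (p ^ i) + Polynomial.monom (b ^ (p ^ i)) (2 * p ^ i)) 2 = (if i = 0 then b else 0)"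
        by auto
    qed
    then show ?thesis using n_pos by simp
  qed
  ultimately show ?thesis by simp
qed

section \<open>The code as an injective image of pairs, and its shifts\<close>

definition codeword :: "'a \<times> 'a \<Rightarrow> 'a vec" where
  "codeword w = vec N (\<lambda>k. field_trace p n (fst w * \<alpha> ^ k + snd w * \<alpha> ^ (2 * k)))"

definition act :: "'a \<Rightarrow> 'a \<times> 'a \<Rightarrow> 'a \<times> 'a" where
  "act x w = (x * fst w, x\<^sup>2 * snd w)"

lemma dual_BCH3_eq: "dual_BCH3 p n N \<alpha> = range codeword"
  by (auto simp: dual_BCH3_def codeword_def image_def)

lemma dim_codeword [simp]: "dim_vec (codeword w) = N"
  by (simp add: codeword_def)

lemma index_codeword:
  "k < N \<Longrightarrow> codeword w $ k = field_trace p n (fst w * \<alpha> ^ k + snd w * (\<alpha> ^ k)\<^sup>2)"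
  by (simp add: codeword_def power_even_eq)

lemma codeword_add: "codeword (w + z) = codeword w + codeword z"
  by (rule eq_vecI) (simp_all add: codeword_def distrib_right flip: field_trace_add, simp add: algebra_simps)

lemma codeword_scale:
  assumes "a \<in> prime_subfield"
  shows "codeword (a * fst w, a * snd w) = a \<cdot>\<^sub>v codeword w"
  by (rule eq_vecI) (simp_all add: codeword_def algebra_simps flip: field_trace_scale[OF assms])

lemma alpha_power_mod: "\<alpha> ^ (j mod N) = \<alpha> ^ j"
proof -
  have "\<alpha> ^ (N * (j div N) + j mod N) = \<alpha> ^ (j mod N)"
    using power_N[OF alpha_nonzero] by (simp only: power_add power_mult) simp
  then show ?thesis by simp
qed

text \<open>The positions k < N run through all nonzero elements \<open>\<alpha> ^ k\<close>, so a
  zero word makes the trace form vanish at every nonzero point.\<close>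

lemma codeword_eq_0_iff: "codeword w = 0\<^sub>v N \<longleftrightarrow> w = 0"
proof
  assume w: "codeword w = 0\<^sub>v N"
  have "field_trace p n (fst w * x + snd w * x\<^sup>2) = 0" if x: "x \<noteq> 0" for x
  proof -
    obtain j where "x = \<alpha> ^ j" using x by (rule nonzero_eq_power)
    then have "x = \<alpha> ^ (j mod N)" by (simp add: alpha_power_mod)
    moreover have "j mod N < N" using N_pos by simp
    ultimately show ?thesis using index_codeword[of "j mod N" w] w by simp
  qed
  then have "fst w = 0 \<and> snd w = 0" by (rule trace_form_eq_0)
  then show "w = 0" by (simp add: prod_eq_iff)
next
  assume "w = 0"
  then show "codeword w = 0\<^sub>v N"
    using power_p_ne_0 by (auto intro!: eq_vecI simp: codeword_def field_trace_def zero_power)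
qed

lemma inj_codeword: "inj codeword"
proof (rule injI)
  fix w z assume eq: "codeword w = codeword z"
  have "codeword ((w - z) + z) = codeword (w - z) + codeword z" by (rule codeword_add)
  then have *: "codeword z = codeword (w - z) + codeword z" using eq by simp
  have "codeword (w - z) = 0\<^sub>v N"
  proof (rule eq_vecI)
    fix i assume "i < dim_vec (0\<^sub>v N :: 'a vec)"
    then show "codeword (w - z) $ i = 0\<^sub>v N $ i"
      using arg_cong[OF *, of "\<lambda>c. c $ i"] by simp
  qed simp
  then show "w = z" by (simp add: codeword_eq_0_iff)
qed

lemma cyclic_shift_codeword: "cyclic_shift (codeword w) = codeword (act (inverse \<alpha>) w)"
proof (rule eq_vecI)
  fix k assume "k < dim_vec (codeword (act (inverse \<alpha>) w))"
  then have k: "k < N" by simp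
  let ?m = "(k + N - 1) mod N"
  have m: "?m < N" using N_pos by simp
  \<comment> \<open>Position k receives the entry from k - 1, or from N - 1 when k = 0; since
    \<open>\<alpha> ^ N = 1\<close>, both cases multiply the evaluation point by
    \<open>inverse \<alpha>\<close>.\<close>
  have "\<alpha> ^ ?m * \<alpha> = \<alpha> ^ (k + N)"
    using N_pos by (simp add: alpha_power_mod flip: power_Suc2)
  also have "\<dots> = \<alpha> ^ k" using power_N[OF alpha_nonzero] by (simp add: power_add)
  finally have eq: "\<alpha> ^ ?m = inverse \<alpha> * \<alpha> ^ k" using alpha_nonzero by (simp add: field_simps)
  have "cyclic_shift (codeword w) $ k = codeword w $ ?m" using k by (simp add: cyclic_shift_def)
  also have "\<dots> = codeword (act (inverse \<alpha>) w) $ k"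
    unfolding index_codeword[OF m] index_codeword[OF k] eq
    by (simp add: act_def power_mult_distrib algebra_simps)
  finally show "cyclic_shift (codeword w) $ k = codeword (act (inverse \<alpha>) w) $ k" .
qed (simp add: cyclic_shift_def)

lemma cyclic_shift_funpow_codeword:
  "(cyclic_shift ^^ l) (codeword w) = codeword (act (inverse \<alpha> ^ l) w)"
proof (induction l)
  case (Suc l)
  have "act (inverse \<alpha>) (act (inverse \<alpha> ^ l) w) = act (inverse \<alpha> ^ Suc l) w"
    by (simp add: act_def power_mult_distrib mult.assoc)
  then show ?case using Suc by (simp add: cyclic_shift_codeword)
qed (simp add: act_def)

lemma mem_weighted_stabilizer_iff:
  "x \<in> weighted_stabilizer W \<longleftrightarrow> x \<noteq> 0 \<and> (\<forall>w\<in>W. act x w \<in> W)"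
  by (auto simp: weighted_stabilizer_def act_def)

lemma shift_invariant_codewords_iff:
  "shift_invariant l (codeword ` W) \<longleftrightarrow> inverse \<alpha> ^ l \<in> weighted_stabilizer W"
  using alpha_nonzero
  by (simp add: shift_invariant_def cyclic_shift_funpow_codeword mem_weighted_stabilizer_iff
      inj_image_mem_iff[OF inj_codeword])

text \<open>\<open>act\<close> is multiplicative in its first argument, so the stabilizer of any set
  of pairs is closed under products.\<close>

lemma weighted_stabilizer_eq_roots:
  obtains e where "e dvd N" "weighted_stabilizer (W :: ('a \<times> 'a) set) = {x. x ^ e = 1}"
proof -
  have act_mult: "act (x * y) w = act x (act y w)" for x y w
    by (simp add: act_def power_mult_distrib mult.assoc)
  show ?thesis
    by (rule mult_closed_eq_roots[of "weighted_stabilizer W"])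
      (auto simp: mem_weighted_stabilizer_iff act_mult intro: that, simp add: act_def)
qed

text \<open>If the stabilizer consists of the e'-th roots of unity, the shift by l preserves the
  code iff \<open>N div e'\<close> divides l. The least such positive l is that quotient, so index
  and order determine each other.\<close>

lemma quasi_cyclic_codewords_iff:
  assumes "N = L * e"
  shows "quasi_cyclic N L (codeword ` W) \<longleftrightarrow>
    linear_code N (codeword ` W) \<and> weighted_stabilizer W = {x. x ^ e = 1}"
proof -
  obtain e' where e': "e' dvd N" "weighted_stabilizer W = {x. x ^ e' = 1}"
    by (rule weighted_stabilizer_eq_roots)
  then obtain L' where L': "N = L' * e'" by (metis dvd_div_mult_self)
  have "0 < L'" using L' N_pos by auto
  moreover have "0 < L" "0 < e" using assms N_pos by auto
  ultimately have pos: "0 < L" "0 < L'" "0 < e" by auto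
  have inv: "shift_invariant l (codeword ` W) \<longleftrightarrow> L' dvd l" for l
    using alpha_power_root_iff[OF L', of l] alpha_nonzero
    by (simp add: shift_invariant_codewords_iff e'(2) power_inverse)
  have "shift_invariant L (codeword ` W) \<and> (\<forall>m. 0 < m \<and> m < L \<longrightarrow> \<not> shift_invariant m (codeword ` W)) \<longleftrightarrow> L = L'"
    unfolding inv
  proof
    assume *: "L' dvd L \<and> (\<forall>m. 0 < m \<and> m < L \<longrightarrow> \<not> L' dvd m)"
    then have "L' \<le> L" using pos by (auto dest: dvd_imp_le)
    moreover have "\<not> L' < L" using conjunct2[OF *, rule_format, of L'] pos(2) by auto
    ultimately show "L = L'" by simp
  qed (auto dest: dvd_imp_le)
  moreover have "L = L' \<longleftrightarrow> e = e'"
    using assms L' pos by (metis mult_cancel1 mult_cancel2 neq0_conv)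
  moreover have "weighted_stabilizer W = {x. x ^ e = 1} \<longleftrightarrow> e = e'"
  proof -
    have "e dvd N" using assms by simp
    then show ?thesis using card_roots[of e] card_roots[OF e'(1)] e'(2) by metis
  qed
  ultimately show ?thesis using pos(1) by (auto simp: quasi_cyclic_def)
qed

lemma linear_code_codewords_iff:
  "linear_code N (codeword ` W) \<longleftrightarrow>
    0 \<in> W \<and> (\<forall>w\<in>W. \<forall>z\<in>W. w + z \<in> W) \<and> (\<forall>a\<in>prime_subfield. \<forall>w\<in>W. (a * fst w, a * snd w) \<in> W)"
proof -
  have "codeword w \<in> {c \<in> carrier_vec N. \<forall>k<N. c $ k \<in> prime_subfield}" for w
    using field_trace_mem by (simp add: codeword_def)
  then have "codeword ` W \<subseteq> {c \<in> carrier_vec N. \<forall>k<N. c $ k \<in> prime_subfield}" by blast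
  moreover have "0\<^sub>v N \<in> codeword ` W \<longleftrightarrow> 0 \<in> W"
    using codeword_eq_0_iff[of 0] inj_image_mem_iff[OF inj_codeword, of 0 W] by simp
  ultimately show ?thesis
    unfolding linear_code_def
    by (simp add: inj_image_mem_iff[OF inj_codeword] flip: codeword_add codeword_scale)
qed

text \<open>
  The element -1 acts by (l, b) \<mapsto> (-l, b), so invariance under it splits a subspace of pairs.
\<close>

lemma split_of_minus_1_mem:
  assumes W: "0 \<in> (W :: ('a \<times> 'a) set)" "\<And>w z. w \<in> W \<Longrightarrow> z \<in> W \<Longrightarrow> w + z \<in> W"
    "\<And>a w. a \<in> prime_subfield \<Longrightarrow> w \<in> W \<Longrightarrow> (a * fst w, a * snd w) \<in> W"
    and m1: "- 1 \<in> weighted_stabilizer W"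
  shows "W = fst ` W \<times> snd ` W"
    and "subspace_over prime_subfield (fst ` W)" "subspace_over prime_subfield (snd ` W)"
proof -
  have K: "subfield_set (prime_subfield :: 'a set)"
    unfolding prime_subfield_eq by (rule subfield_set_fixed_field)
  have two: "(2 :: 'a) \<noteq> 0"
  proof
    assume "(2 :: 'a) = 0"
    then have "of_nat 2 = (0 :: 'a)" by simp
    then have "p dvd 2" by (simp only: of_nat_eq_0_iff_char_dvd CHAR_eq)
    then show False using p_gt_2 by (auto dest: dvd_imp_le)
  qed
  have "of_nat 2 \<in> (prime_subfield :: 'a set)" unfolding prime_subfield_def by (rule rangeI)
  then have half: "inverse 2 \<in> (prime_subfield :: 'a set)" and m1K: "- 1 \<in> (prime_subfield :: 'a set)"
    using K unfolding subfield_set_def by auto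
  \<comment> \<open>Half the sum of (a, b) and (-a, b); 2 is invertible because p is odd.\<close>
  have snd_part: "(0, b) \<in> W" if "(a, b) \<in> W" for a b
  proof -
    have "(- a, b) \<in> W" using m1 that by (auto simp: weighted_stabilizer_def)
    from W(3)[OF half W(2)[OF this that]] show ?thesis using two by (simp add: field_simps)
  qed
  have fst_part: "(a, 0) \<in> W" if "(a, b) \<in> W" for a b
    using W(2)[OF that W(3)[OF m1K snd_part[OF that]]] by simp
  show "W = fst ` W \<times> snd ` W"
  proof (intro equalityI subsetI)
    fix z assume "z \<in> fst ` W \<times> snd ` W"
    then obtain a b c d where *: "z = (a, d)" "(a, b) \<in> W" "(c, d) \<in> W" by auto
    from W(2)[OF fst_part[OF *(2)] snd_part[OF *(3)]] show "z \<in> W" using *(1) by simp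
  qed (auto intro: rev_image_eqI)
  show "subspace_over prime_subfield (fst ` W)"
  proof (rule subspace_overI)
    show "0 \<in> fst ` W" using W(1) by (intro image_eqI[of _ _ 0]) auto
  next
    fix x y assume "x \<in> fst ` W" "y \<in> fst ` W"
    then obtain w z where "x = fst w" "w \<in> W" "y = fst z" "z \<in> W" by blast
    then show "x + y \<in> fst ` W" using W(2)[of w z] by (intro image_eqI[of _ _ "w + z"]) auto
  next
    fix a x :: 'a assume "a \<in> prime_subfield" "x \<in> fst ` W"
    then obtain w where "x = fst w" "w \<in> W" "a \<in> prime_subfield" by blast
    then show "a * x \<in> fst ` W"
      using W(3)[of a w] by (intro image_eqI[of _ _ "(a * fst w, a * snd w)"]) auto
  qed
  show "subspace_over prime_subfield (snd ` W)"
  proof (rule subspace_overI)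
    show "0 \<in> snd ` W" using W(1) by (intro image_eqI[of _ _ 0]) auto
  next
    fix x y assume "x \<in> snd ` W" "y \<in> snd ` W"
    then obtain w z where "x = snd w" "w \<in> W" "y = snd z" "z \<in> W" by blast
    then show "x + y \<in> snd ` W" using W(2)[of w z] by (intro image_eqI[of _ _ "w + z"]) auto
  next
    fix a x :: 'a assume "a \<in> prime_subfield" "x \<in> snd ` W"
    then obtain w where "x = snd w" "w \<in> W" "a \<in> prime_subfield" by blast
    then show "a * x \<in> snd ` W"
      using W(3)[of a w] by (intro image_eqI[of _ _ "(a * fst w, a * snd w)"]) auto
  qed
qed

section \<open>Subcodes of a given index as pairs of subspaces\<close>

lemma num_qc_subcodes_eq_card:
  assumes N: "N = L * e" and "even e"
  shows "num_qc_subcodes N (dual_BCH3 p n N \<alpha>) L = card (subspace_pairs e - {({0}, {0})})"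
proof -
  let ?f = "\<lambda>(W, W'). codeword ` (W \<times> W')"
  let ?X = "subspace_pairs e - {({0}, {0})}"
  let ?C = "dual_BCH3 p n N \<alpha>"
  have inj: "inj_on ?f ?X"
  proof (rule inj_onI)
    fix z z' assume z: "z \<in> ?X" "z' \<in> ?X" "?f z = ?f z'"
    obtain W W' V V' where zW: "z = (W, W')" "z' = (V, V')" by (cases z, cases z')
    have *: "(W, W') \<in> subspace_pairs e" "codeword ` (W \<times> W') = codeword ` (V \<times> V')"
      using z zW by auto
    then have "W \<times> W' = V \<times> V'" by (simp add: inj_image_eq_iff[OF inj_codeword])
    \<comment> \<open>Nonempty factors are determined by their product, which gives
      injectivity.\<close>
    moreover have "0 \<in> W" "0 \<in> W'" using *(1) by (auto simp: subspace_pairs_def subspace_over_def)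
    ultimately show "z = z'" using zW by (auto simp: times_eq_iff)
  qed
  have "{D \<in> subcodes N ?C. quasi_cyclic N L D} = ?f ` ?X"
  proof (intro equalityI subsetI)
    fix D assume D: "D \<in> {D \<in> subcodes N ?C. quasi_cyclic N L D}"
    then have "D \<subseteq> range codeword" by (simp add: subcodes_def dual_BCH3_eq)
    then obtain W where W: "D = codeword ` W" by (auto simp: subset_image_iff)
    have lin: "linear_code N (codeword ` W)" and st: "weighted_stabilizer W = {x. x ^ e = 1}"
      using D quasi_cyclic_codewords_iff[OF N] by (auto simp: W)
    \<comment> \<open>This is where evenness of e enters: -1 is an e-th root of unity.\<close>
    have m1: "- 1 \<in> weighted_stabilizer W" using st assms(2) by simp
    have W_add: "0 \<in> W" "\<And>w z. w \<in> W \<Longrightarrow> z \<in> W \<Longrightarrow> w + z \<in> W"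
      "\<And>a w. a \<in> prime_subfield \<Longrightarrow> w \<in> W \<Longrightarrow> (a * fst w, a * snd w) \<in> W"
      using lin unfolding linear_code_codewords_iff by blast+
    note split = split_of_minus_1_mem[OF W_add m1]
    have "W \<noteq> {0}"
    proof
      assume "W = {0}"
      then have "D = {0\<^sub>v N}" using W codeword_eq_0_iff[of 0] by simp
      then show False using D by (simp add: subcodes_def)
    qed
    then have "fst ` W \<times> snd ` W \<noteq> {0} \<times> {0}"
      using split(1) by (simp add: zero_prod_def)
    then have "(fst ` W, snd ` W) \<noteq> ({0}, {0})" by auto
    moreover have "(fst ` W, snd ` W) \<in> subspace_pairs e"
      using split(2,3) st by (simp add: subspace_pairs_def flip: split(1))
    moreover have "D = ?f (fst ` W, snd ` W)"
      using W by (simp flip: split(1))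
    ultimately show "D \<in> ?f ` ?X" by blast
  next
    fix D assume "D \<in> ?f ` ?X"
    then obtain W W' where *: "(W, W') \<in> ?X" "D = codeword ` (W \<times> W')" by auto
    then have sub: "subspace_over prime_subfield W" "subspace_over prime_subfield W'"
      and st: "weighted_stabilizer (W \<times> W') = {x. x ^ e = 1}"
      by (auto simp: subspace_pairs_def)
    then have lin: "linear_code N D"
      unfolding *(2) linear_code_codewords_iff by (auto simp: subspace_over_def zero_prod_def)
    have "W \<times> W' \<noteq> {0} \<times> {0}"
      using *(1) sub by (auto simp: times_eq_iff subspace_over_def)
    then have "W \<times> W' \<noteq> {0}" by (simp add: zero_prod_def)
    then have "D \<noteq> codeword ` {0}" by (simp add: *(2) inj_image_eq_iff[OF inj_codeword] del: image_insert image_empty)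
    then have "D \<noteq> {0\<^sub>v N}" using codeword_eq_0_iff[of 0] by simp
    moreover have "quasi_cyclic N L D" using lin st quasi_cyclic_codewords_iff[OF N] *(2) by simp
    ultimately show "D \<in> {D \<in> subcodes N ?C. quasi_cyclic N L D}"
      using lin *(2) by (auto simp: subcodes_def dual_BCH3_eq)
  qed
  then show ?thesis using card_image[OF inj] by (simp add: num_qc_subcodes_def)
qed

text \<open>Since the order determines c and g, the contributing pairs (d, d') can be selected by
  their gcd and by the parity of \<open>d div gcd d d'\<close>. The final subtraction removes the
  zero code.\<close>

lemma real_num_qc_subcodes:
  assumes N: "N = L * (c * (p ^ g - 1))" and c: "c \<in> {1, 2}" and g: "0 < g"
  shows "real (num_qc_subcodes N (dual_BCH3 p n N \<alpha>) L) =
    (\<Sum>d | d dvd n. \<Sum>d' | d' dvd n.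
      if (if even (d div gcd d d') then 2 else 1) = c \<and> gcd d d' = g
      then real (stab_count d) * real (stab_count d') else 0) -
    (if c = 1 \<and> g = n then 1 else 0)"
proof -
  let ?e = "c * (p ^ g - 1)"
  let ?D = "{d. d dvd n}"
  let ?k = "\<lambda>d d'. (if even (d div gcd d d') then 2 else 1 :: nat)"
  have e: "?e dvd N" using N by simp
  have e_N: "?e = N \<longleftrightarrow> c = 1 \<and> g = n"
    using scaled_power_diff_one_eq_iff[OF p_gt_2 g n_pos c, of 1] by (simp add: N_def)
  have h: "gcd (p ^ d - 1) (2 * (p ^ d' - 1)) = ?e \<longleftrightarrow> ?k d d' = c \<and> gcd d d' = g"
    if "d \<in> ?D" "d' \<in> ?D" for d d'
  proof -
    have pos: "0 < d" "0 < d'" using that n_pos by (auto intro: dvd_pos_nat)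
    then have "0 < gcd d d'" by simp
    moreover have "1 < p" using p_gt_2 by simp
    ultimately show ?thesis
      using gcd_power_diff_one_twice[OF odd_p _ pos] scaled_power_diff_one_eq_iff[OF p_gt_2 _ g _ c, of "gcd d d'" "?k d d'"]
      by simp
  qed
  have "real (card (subspace_pairs ?e)) =
      (\<Sum>(d, d') | d dvd n \<and> d' dvd n \<and> gcd (p ^ d - 1) (2 * (p ^ d' - 1)) = ?e.
        real (stab_count d) * real (stab_count d'))"
    unfolding card_subspace_pairs[OF e] by (simp add: case_prod_unfold)
  also have "{(d, d'). d dvd n \<and> d' dvd n \<and> gcd (p ^ d - 1) (2 * (p ^ d' - 1)) = ?e} =
      {z \<in> ?D \<times> ?D. ?k (fst z) (snd z) = c \<and> gcd (fst z) (snd z) = g}"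
    using h by auto
  also have "(\<Sum>(d, d')\<in>\<dots>. real (stab_count d) * real (stab_count d')) =
      (\<Sum>z\<in>?D \<times> ?D. if ?k (fst z) (snd z) = c \<and> gcd (fst z) (snd z) = g
        then real (stab_count (fst z)) * real (stab_count (snd z)) else 0)"
    using finite_divisors_n by (simp only: case_prod_unfold, subst sum.inter_filter) simp_all
  also have "\<dots> = (\<Sum>d\<in>?D. \<Sum>d'\<in>?D. if ?k d d' = c \<and> gcd d d' = g
        then real (stab_count d) * real (stab_count d') else 0)"
    by (simp add: sum.cartesian_product case_prod_unfold)
  finally have card: "real (card (subspace_pairs ?e)) = \<dots>" .
  have fin: "finite (subspace_pairs ?e)" by simp
  \<comment> \<open>Already \<open>p ^ g - 1\<close> is even, so every order of this form admits the
    splitting.\<close>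
  have "even ?e" using odd_p g by simp
  then have "num_qc_subcodes N (dual_BCH3 p n N \<alpha>) L = card (subspace_pairs ?e - {({0}, {0})})"
    by (rule num_qc_subcodes_eq_card[OF N])
  also have "real \<dots> = real (card (subspace_pairs ?e)) - (if c = 1 \<and> g = n then 1 else 0)"
  proof (cases "c = 1 \<and> g = n")
    case True
    then have mem: "({0}, {0}) \<in> subspace_pairs ?e"
      using zero_pair_mem_subspace_pairs_iff[OF e] e_N by blast
    then have "0 < card (subspace_pairs ?e)" using fin by (auto simp: card_gt_0_iff)
    then show ?thesis using mem True by (simp add: card_Diff_singleton of_nat_diff)
  next
    case False
    then have "({0}, {0}) \<notin> subspace_pairs ?e"
      using zero_pair_mem_subspace_pairs_iff[OF e] e_N by blast
    then show ?thesis using False by simp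
  qed
  finally show ?thesis unfolding card .
qed

end

section \<open>Evaluation of the counts for n = u v\<close>

theorem theorem5p6:
  fixes p u v n N L1 L2 L3 :: nat
    and \<alpha> :: "'a :: {field, finite}"
    and C :: "'a vec set"
    and A :: real
  assumes "prime p" and "odd p"
    and "prime u" and "prime v" and "u \<noteq> v"
    and "n = u * v"
    and "N = p ^ (u * v) - 1"
    and "CARD('a) = p ^ n"
    and "primitive_element \<alpha>"
    and "C = dual_BCH3 p n N \<alpha>"
    and "L1 = (p ^ (u * v) - 1) div (p - 1)"
    and "L2 = (p ^ (u * v) - 1) div (p ^ u - 1)"
    and "L3 = (p ^ (u * v) - 1) div (p ^ v - 1)"
    and "A = num_subspaces (u * v) p - num_subspaces u (p ^ v) - num_subspaces v (p ^ u) + 1"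
  shows "card {D \<in> subcodes N C. cyclic_code N D} = 3 \<and>
    (odd u \<and> odd v \<longrightarrow>
      real (num_qc_subcodes N C L1) =
        A + A * (num_subspaces (u * v) p + num_subspaces u (p ^ v) + num_subspaces v (p ^ u))
          + 2 * (num_subspaces u (p ^ v) * num_subspaces v (p ^ u)
                  - num_subspaces u (p ^ v) - num_subspaces v (p ^ u) + 1) \<and>
      real (num_qc_subcodes N C L2) =
        2 * num_subspaces v (p ^ u) + (num_subspaces v (p ^ u))\<^sup>2 - 3 \<and>
      real (num_qc_subcodes N C L3) =
        2 * num_subspaces u (p ^ v) + (num_subspaces u (p ^ v))\<^sup>2 - 3) \<and>
    (u = 2 \<and> odd v \<longrightarrow>
      real (num_qc_subcodes N C L1) =
        A + A * num_subspaces (u * v) p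
          + (num_subspaces u (p ^ v) - 1) * (A + num_subspaces v (p ^ u) - 1) \<and>
      real (num_qc_subcodes N C (L1 div 2)) =
        2 * A + (num_subspaces v (p ^ u) - 1) * (A + num_subspaces u (p ^ v) - 1) \<and>
      real (num_qc_subcodes N C L2) =
        2 * num_subspaces v (p ^ u) + (num_subspaces v (p ^ u))\<^sup>2 - 3 \<and>
      real (num_qc_subcodes N C L3) = (num_subspaces u (p ^ v))\<^sup>2 - 1 \<and>
      real (num_qc_subcodes N C (L3 div 2)) = 2 * (num_subspaces u (p ^ v) - 1))"
proof -
  interpret primitive_field p n N \<alpha>
    using assms by unfold_locales auto
  have p1: "1 < p" using p_gt_2 by simp
  have u1: "1 < u" and v1: "1 < v" using assms(3,4) by (auto dest: prime_gt_1_nat)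
  have pos: "0 < u" "0 < v" using u1 v1 by auto
  have distinct: "u \<noteq> 1" "v \<noteq> 1" "u * v \<noteq> 1" "u * v \<noteq> u" "u * v \<noteq> v" "u \<noteq> v"
    "1 \<noteq> u" "1 \<noteq> v" "1 \<noteq> u * v" "u \<noteq> u * v" "v \<noteq> u * v" "v \<noteq> u"
    using u1 v1 assms(5) by auto
  have coprime: "gcd u v = 1" "gcd v u = 1"
    using primes_coprime[OF assms(3,4,5)] by (simp_all add: coprime_iff_gcd_eq_1 gcd.commute)
  have not_dvd: "\<not> u dvd v" "\<not> v dvd u"
    using assms(3-5) by (auto dest: primes_dvd_imp_eq)
  have div_n: "{d. d dvd n} = {1, u, v, u * v}"
    unfolding assms(6) by (rule divisors_prime_mult[OF assms(3,4)])
  have above: "{d'. d' dvd n \<and> d dvd d'} = {d' \<in> {1, u, v, u * v}. d dvd d'}" for d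
    using div_n by blast

  \<comment> \<open>The triangular system is solved from the top: over the whole field only the zero
    subspace and the field itself occur.\<close>
  have c_n: "real (stab_count (u * v)) = 2"
  proof -
    have S: "{d'. d' dvd n \<and> u * v dvd d'} = {u * v}"
      unfolding above using distinct pos by (auto dest: dvd_imp_le)
    show ?thesis
      using sum_stab_count[of "u * v"] num_subspaces_1[OF power_p_gt_1[OF n_pos]] pos
      unfolding S unfolding assms(6) by simp
  qed
  have c_u: "real (stab_count u) = num_subspaces v (p ^ u) - 1"
  proof -
    have S: "{d'. d' dvd n \<and> u dvd d'} = {u, u * v}"
      unfolding above using distinct not_dvd by auto
    show ?thesis
      using sum_stab_count[of u] c_n pos distinct unfolding S unfolding assms(6) by simp
  qed
  have c_v: "real (stab_count v) = num_subspaces u (p ^ v) - 1"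
  proof -
    have S: "{d'. d' dvd n \<and> v dvd d'} = {v, u * v}"
      unfolding above using distinct not_dvd by auto
    show ?thesis
      using sum_stab_count[of v] c_n pos distinct unfolding S unfolding assms(6) by simp
  qed
  \<comment> \<open>All prime-field subspaces number \<open>num_subspaces (u * v) p + 1\<close>;
    subtracting the three larger stabilizer classes leaves A.\<close>
  have c_1: "real (stab_count 1) = A"
  proof -
    have S: "{d'. d' dvd n \<and> 1 dvd d'} = {1, u, v, u * v}"
      unfolding above by auto
    show ?thesis
      using sum_stab_count[of 1] c_n c_u c_v distinct unfolding S unfolding assms(6,14) by simp
  qed
  define s where "s d = real (stab_count d)" for d
  have s: "s 1 = A" "s (Suc 0) = A" "s u = num_subspaces v (p ^ u) - 1" "s v = num_subspaces u (p ^ v) - 1" "s (u * v) = 2"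
    using c_1 c_u c_v c_n by (simp_all add: s_def)

  define T where "T c g = (\<Sum>d\<in>{1, u, v, u * v}. \<Sum>d'\<in>{1, u, v, u * v}.
      if (if even (d div gcd d d') then 2 else 1) = c \<and> gcd d d' = g then s d * s d' else 0)" for c g :: nat
  have num: "real (num_qc_subcodes N C L) = T c g - (if c = 1 \<and> g = u * v then 1 else 0)"
    if "N = L * (c * (p ^ g - 1))" "c \<in> {1, 2}" "0 < g" for L c g
    using real_num_qc_subcodes[OF that] unfolding div_n assms(10) T_def s_def unfolding assms(6) .
  have gcds: "gcd u (u * v) = u" "gcd v (u * v) = v" "gcd (u * v) u = u" "gcd (u * v) v = v"
    by simp_all
  have divs: "u * v div u = v" "u * v div v = u" "u * v div (u * v) = 1" "u div u = 1" "v div v = 1"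
    using pos by simp_all
  have sum4: "(\<Sum>d\<in>{1, u, v, u * v}. f d) = f 1 + f u + f v + f (u * v)" for f :: "nat \<Rightarrow> real"
    using distinct by simp
  note T = T_def sum4 gcds divs coprime distinct gcd_1_nat gcd_nat.left_neutral gcd_nat.right_neutral

  have N1: "N = L1 * (p - 1)"
    using power_diff_one_dvd[of 1 "u * v" p] p1 by (simp add: assms(7,11))
  have N2: "N = L2 * (p ^ u - 1)"
    using power_diff_one_dvd[of u "u * v" p] p1 by (simp add: assms(7,12))
  have N3: "N = L3 * (p ^ v - 1)"
    using power_diff_one_dvd[of v "u * v" p] p1 by (simp add: assms(7,13))

  have cyclic: "card {D \<in> subcodes N C. cyclic_code N D} = 3"
  proof -
    have "real (num_qc_subcodes N C 1) = T 1 (u * v) - 1"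
      using num[of 1 1 "u * v"] pos by (simp add: assms(7))
    \<comment> \<open>A gcd equal to u v forces d = d' = u v, hence 2 * 2 pairs.\<close>
    also have "T 1 (u * v) = 4" using distinct pos by (simp add: T s)
    finally show ?thesis by (simp add: num_qc_subcodes_def cyclic_code_def)
  qed
  \<comment> \<open>Here g is a proper divisor of u v, so no correction for the zero code
    appears.\<close>
  have L: "real (num_qc_subcodes N C L1) = T 1 1" "real (num_qc_subcodes N C L2) = T 1 u"
    "real (num_qc_subcodes N C L3) = T 1 v"
    using num[of L1 1 1] num[of L2 1 u] num[of L3 1 v] N1 N2 N3 pos distinct by simp_all
  \<comment> \<open>Eliminating this count in favour of A turns the claims for \<open>L1\<close>
    into polynomial identities in A and the other two counts.\<close>
  have Z: "num_subspaces (u * v) p = A + num_subspaces u (p ^ v) + num_subspaces v (p ^ u) - 1"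
    using assms(14) by simp
  have half1: "real (num_qc_subcodes N C (L1 div 2)) = T 2 1"
    and half3: "real (num_qc_subcodes N C (L3 div 2)) = T 2 v" if "u = 2"
  proof -
    \<comment> \<open>\<open>L1\<close> is a sum of u v odd terms and \<open>L3\<close> a sum of u
      odd terms, both even for u = 2, so the halved indices are integers and correspond to c =
      2.\<close>
    have "even L1"
      using even_geometric_quotient[OF odd_p p1, of "u * v"] that by (simp add: assms(11))
    then have "N = L1 div 2 * (2 * (p ^ 1 - 1))" using N1 by (metis dvd_div_mult_self mult.assoc power_one_right)
    then show "real (num_qc_subcodes N C (L1 div 2)) = T 2 1" using num[of "L1 div 2" 2 1] by simp
    have "odd (p ^ v)" "1 < p ^ v" using odd_p power_p_gt_1[OF pos(2)] by auto
    then have "even L3"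
      using even_geometric_quotient[of "p ^ v" u] that by (simp add: assms(13) mult.commute flip: power_mult)
    then have "N = L3 div 2 * (2 * (p ^ v - 1))" using N3 by (metis dvd_div_mult_self mult.assoc)
    then show "real (num_qc_subcodes N C (L3 div 2)) = T 2 v" using num[of "L3 div 2" 2 v] pos by simp
  qed
  show ?thesis
  proof (intro conjI impI cyclic; (elim conjE)?)
    \<comment> \<open>Every quotient \<open>d div gcd d d'\<close> is odd here, so all sixteen pairs
      have c = 1 and are sorted by gcd alone.\<close>
    assume odd: "odd u" "odd v"
    show "real (num_qc_subcodes N C L1) =
        A + A * (num_subspaces (u * v) p + num_subspaces u (p ^ v) + num_subspaces v (p ^ u))
          + 2 * (num_subspaces u (p ^ v) * num_subspaces v (p ^ u)
                  - num_subspaces u (p ^ v) - num_subspaces v (p ^ u) + 1)"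
      unfolding L Z using odd distinct pos by (simp add: T s algebra_simps)
    show "real (num_qc_subcodes N C L2) =
        2 * num_subspaces v (p ^ u) + (num_subspaces v (p ^ u))\<^sup>2 - 3"
      unfolding L using odd distinct pos by (simp add: T s algebra_simps power2_eq_square)
    show "real (num_qc_subcodes N C L3) =
        2 * num_subspaces u (p ^ v) + (num_subspaces u (p ^ v))\<^sup>2 - 3"
      unfolding L using odd distinct pos by (simp add: T s algebra_simps power2_eq_square)
  next
    assume u: "u = 2" and odd: "odd v"
    \<comment> \<open>Now c = 2 for the pairs (u, 1), (u, v), (u v, 1) with gcd 1 and for (u v, v)
      with gcd v; these move from the indices \<open>L1\<close> and \<open>L3\<close> to their
      halves, while no pair leaves \<open>L2\<close>.\<close>
    then have even: "even u" by simp
    show "real (num_qc_subcodes N C L1) =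
        A + A * num_subspaces (u * v) p
          + (num_subspaces u (p ^ v) - 1) * (A + num_subspaces v (p ^ u) - 1)"
      unfolding L Z using odd even distinct pos by (simp add: T s algebra_simps)
    show "real (num_qc_subcodes N C (L1 div 2)) =
        2 * A + (num_subspaces v (p ^ u) - 1) * (A + num_subspaces u (p ^ v) - 1)"
      unfolding half1[OF u] using odd even distinct pos by (simp add: T s algebra_simps)
    show "real (num_qc_subcodes N C L2) =
        2 * num_subspaces v (p ^ u) + (num_subspaces v (p ^ u))\<^sup>2 - 3"
      unfolding L using odd even distinct pos by (simp add: T s algebra_simps power2_eq_square)
    show "real (num_qc_subcodes N C L3) = (num_subspaces u (p ^ v))\<^sup>2 - 1"
      unfolding L using odd even distinct pos by (simp add: T s algebra_simps power2_eq_square)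
    show "real (num_qc_subcodes N C (L3 div 2)) = 2 * (num_subspaces u (p ^ v) - 1)"
      unfolding half3[OF u] using odd even distinct pos by (simp add: T s algebra_simps)
  qed
qed

end
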